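(* Consider a $K\times N$ input-queued crossbar multicast switch (fanout splitting and linear intra-flow network coding allowed) loaded with a fixed traffic pattern, and let $G$ be its enhanced conflict graph. Let $\mathbf{A}$ be the admissible rate region, $\mathbf{R}$ the achievable rate region, and $s_{\min}=\min\{s : \mathbf{A}\subseteq s\,\mathbf{R}\}$ the minimum speedup required to achieve all admissible rates. Then $s_{\min}\le \operatorname{imp}(G)$.
   Context: Switch model: inputs $[K]=\{1,\dots,K\}$, outputs $[N]$; time is slotted; rates are in packets per slot. A flow is a pair $(i,J)$ with input $i$ and nonempty fanout set $J\subseteq[N]$; a traffic pattern is a finite set of flows, and a rate vector $\mathbf r$ assigns a rate $r_{iJ}\ge 0$ to each flow. A subflow of $(i,J)$ is a triple $(i,J,j)$ with $j\in J$. In each slot the switch chooses a configuration: each input either idles or picks one of its flows $(i,J)$ and connects to a subset of $J$, sending one packet simultaneously to all connected outputs; each output is connected to at most one input. With linear intra-flow coding the transmitted packet is a linear combination (over a finite field) of packets of that flow present at the input. The knowledge space of a node for a flow is the span of coefficient vectors of packets of that flow it has; the virtual queue of subflow $(i,J,j)$ has size equal to the dimension of input $i$'s knowledge space minus that of output $j$'s, for flow $(i,J)$. Arrivals $a_{iJ}(t)$ to each flow satisfy: time-average of $E[a_{iJ}(t)]$ converges to $r_{iJ}$; $E[a_{iJ}(t)^2\mid H(t)]\le A_{\max}^2$ where $H(t)$ is the history; and for every $\delta>0$ there is $T$ with $E[\frac1T\sum_{k=0}^{T-1}a_{iJ}(t_0+k)\mid H(t_0)]\le r_{iJ}+\delta$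 for all $t_0$. A queue is strongly stable if its time-average expected backlog is finite. $\mathbf r$ is achievable if there exist a schedule and coding scheme making all virtual queues strongly stable; $\mathbf R$ is the set of achievable rate vectors. $\mathbf r$ is admissible if $\mathbf r\ge0$, for each input $i$ the sum of $r_{iJ}$ over flows from $i$ is at most 1, and for each output $j$ the sum of $r_{iJ}$ over flows with $j\in J$ is at most 1; $\mathbf A$ is the set of admissible vectors. Enhanced conflict graph $G$: one vertex per subflow; distinct subflows $(i,J,j),(i',J',j')$ are adjacent iff $j=j'$, or $i=i'$ and $J\ne J'$. $STAB(G)$ is the convex hull of incidence vectors of stable sets of $G$; $QSTAB(G)=\{x\ge0:\sum_{v\in Q}x_v\le1 \text{ for all cliques } Q\}$; the imperfection ratio is $\operatorname{imp}(G)=\min\{t: QSTAB(G)\subseteq t\,STAB(G)\}$. *)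

theory Defs
  imports "HOL-Probability.Probability" "HOL-Algebra.Ring"
begin

text \<open>Inputs are 1..K, outputs are 1..N. A flow is a pair (i, J) of an input and a fanout
set; a subflow is a triple (i, J, j) with j in J. Time slots are natural numbers.\<close>

type_synonym flow = "nat \<times> nat set"
type_synonym subflow = "nat \<times> nat set \<times> nat"

definition traffic_pattern :: "nat \<Rightarrow> nat \<Rightarrow> flow set \<Rightarrow> bool" where
  "traffic_pattern K N P \<longleftrightarrow> finite P \<and>
     (\<forall>(i, J) \<in> P. i \<in> {1..K} \<and> J \<noteq> {} \<and> J \<subseteq> {1..N})"

definition rate_vector :: "flow set \<Rightarrow> (flow \<Rightarrow> real) \<Rightarrow> bool" where
  "rate_vector P r \<longleftrightarrow> (\<forall>f. f \<notin> P \<longrightarrow> r f = 0) \<and> (\<forall>f. 0 \<le> r f)"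

definition admissible_region :: "flow set \<Rightarrow> (flow \<Rightarrow> real) set" where
  "admissible_region P = {r. rate_vector P r \<and>
     (\<forall>i. (\<Sum>f\<in>{f\<in>P. fst f = i}. r f) \<le> 1) \<and>
     (\<forall>j. (\<Sum>f\<in>{f\<in>P. j \<in> snd f}. r f) \<le> 1)}"

definition scale_set :: "real \<Rightarrow> ('a \<Rightarrow> real) set \<Rightarrow> ('a \<Rightarrow> real) set" where
  "scale_set s X = {(\<lambda>a. s * x a) | x. x \<in> X}"

text \<open>The finite field is an HOL-Algebra ring structure F with carrier a set of naturals
(every finite field is isomorphic to such a structure). Packets of a flow are numbered
0, 1, 2, ... in order of arrival; a coefficient vector is a function from packet numbers to
field elements.\<close>

type_synonym cvec = "nat \<Rightarrow> nat"

definition vzero :: "nat ring \<Rightarrow> cvec" where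
  "vzero F = (\<lambda>_. \<zero>\<^bsub>F\<^esub>)"

definition unitv :: "nat ring \<Rightarrow> nat \<Rightarrow> cvec" where
  "unitv F m = (\<lambda>k. if k = m then \<one>\<^bsub>F\<^esub> else \<zero>\<^bsub>F\<^esub>)"

inductive_set spanF :: "nat ring \<Rightarrow> cvec set \<Rightarrow> cvec set" for F S where
  spanF_zero: "vzero F \<in> spanF F S"
| spanF_add: "v \<in> S \<Longrightarrow> c \<in> carrier F \<Longrightarrow> w \<in> spanF F S \<Longrightarrow>
     (\<lambda>k. (c \<otimes>\<^bsub>F\<^esub> v k) \<oplus>\<^bsub>F\<^esub> w k) \<in> spanF F S"

definition dimF :: "nat ring \<Rightarrow> cvec set \<Rightarrow> nat" where
  "dimF F S = (LEAST n. \<exists>T. finite T \<and> card T = n \<and> T \<subseteq> spanF F S \<and> spanF F T = spanF F S)"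

text \<open>A sample point is the whole arrival sequence: \<open>\<omega> t f\<close> is the number of packets
arriving to flow f in slot t (canonical sample space).\<close>

type_synonym arrivals = "nat \<Rightarrow> flow \<Rightarrow> nat"

definition cumA :: "arrivals \<Rightarrow> flow \<Rightarrow> nat \<Rightarrow> nat" where
  "cumA \<omega> f t = (\<Sum>s<t. \<omega> s f)"

definition input_space :: "nat ring \<Rightarrow> arrivals \<Rightarrow> flow \<Rightarrow> nat \<Rightarrow> cvec set" where
  "input_space F \<omega> f t = spanF F {unitv F m | m. m < cumA \<omega> f t}"

text \<open>A decision in one slot: \<open>conn j = Some f\<close> means output j is connected to the input of
flow f, which transmits for flow f; \<open>coef f\<close> is the coefficient vector of the packet sent for
flow f. Since conn is a function, each output is connected to at most one input.\<close>

type_synonym decision = "(nat \<Rightarrow> flow option) \<times> (flow \<Rightarrow> cvec)"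

definition valid_decision :: "nat ring \<Rightarrow> flow set \<Rightarrow> arrivals \<Rightarrow> nat \<Rightarrow> decision \<Rightarrow> bool" where
  "valid_decision F P \<omega> t d \<longleftrightarrow>
     (\<forall>j f. fst d j = Some f \<longrightarrow> f \<in> P \<and> j \<in> snd f \<and> snd d f \<in> input_space F \<omega> f t) \<and>
     (\<forall>j j' i J J'. fst d j = Some (i, J) \<and> fst d j' = Some (i, J') \<longrightarrow> J = J')"

definition valid_policy :: "nat ring \<Rightarrow> flow set \<Rightarrow> (nat \<Rightarrow> arrivals \<Rightarrow> decision) \<Rightarrow> bool" where
  "valid_policy F P \<pi> \<longleftrightarrow>
     (\<forall>t \<omega> \<omega>'. (\<forall>s<t. \<forall>f\<in>P. \<omega> s f = \<omega>' s f) \<longrightarrow> \<pi> t \<omega> = \<pi> t \<omega>') \<and>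
     (\<forall>t \<omega>. valid_decision F P \<omega> t (\<pi> t \<omega>))"

definition received :: "(nat \<Rightarrow> arrivals \<Rightarrow> decision) \<Rightarrow> flow \<Rightarrow> nat \<Rightarrow> nat \<Rightarrow> arrivals \<Rightarrow> cvec set" where
  "received \<pi> f j t \<omega> = {snd (\<pi> s \<omega>) f | s. s < t \<and> fst (\<pi> s \<omega>) j = Some f}"

definition vqueue :: "nat ring \<Rightarrow> (nat \<Rightarrow> arrivals \<Rightarrow> decision) \<Rightarrow> subflow \<Rightarrow> nat \<Rightarrow> arrivals \<Rightarrow> nat" where
  "vqueue F \<pi> sf t \<omega> = (case sf of (i, J, j) \<Rightarrow>
     dimF F (input_space F \<omega> (i, J) t) - dimF F (received \<pi> (i, J) j t \<omega>))"

definition strongly_stable :: "arrivals measure \<Rightarrow> (nat \<Rightarrow> arrivals \<Rightarrow> nat) \<Rightarrow> bool" where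
  "strongly_stable M Q \<longleftrightarrow>
     limsup (\<lambda>t. (\<Sum>\<tau><t. \<integral>\<^sup>+ \<omega>. ennreal (real (Q \<tau> \<omega>)) \<partial>M) / of_nat t) < \<infinity>"

definition history :: "flow set \<Rightarrow> nat \<Rightarrow> arrivals measure" where
  "history P t = sigma UNIV {{\<omega>. \<omega> s f = n} | s f n. s < t \<and> f \<in> P}"

definition arrival_process :: "flow set \<Rightarrow> (flow \<Rightarrow> real) \<Rightarrow> arrivals measure \<Rightarrow> bool" where
  "arrival_process P r M \<longleftrightarrow>
     prob_space M \<and> space M = UNIV \<and>
     (\<forall>t f. (\<lambda>\<omega>. \<omega> t f) \<in> measurable M (count_space UNIV)) \<and>
     (\<forall>f\<in>P. (\<lambda>t. (\<Sum>s<t. \<integral>\<omega>. real (\<omega> s f) \<partial>M) / real t) \<longlonglongrightarrow> r f) \<and>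
     (\<exists>Amax::real. \<forall>f\<in>P. \<forall>t. AE \<omega> in M.
        nn_cond_exp M (history P t) (\<lambda>\<omega>. ennreal ((real (\<omega> t f))\<^sup>2)) \<omega> \<le> ennreal (Amax\<^sup>2)) \<and>
     (\<forall>f\<in>P. \<forall>\<delta>>0. \<exists>T>0. \<forall>t0. AE \<omega> in M.
        nn_cond_exp M (history P t0) (\<lambda>\<omega>. ennreal ((\<Sum>k<T. real (\<omega> (t0 + k) f)) / real T)) \<omega>
          \<le> ennreal (r f + \<delta>))"

definition achievable :: "flow set \<Rightarrow> (flow \<Rightarrow> real) \<Rightarrow> bool" where
  "achievable P r \<longleftrightarrow> (\<forall>M. arrival_process P r M \<longrightarrow>
     (\<exists>F \<pi>. field F \<and> finite (carrier F) \<and> valid_policy F P \<pi> \<and>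
        (\<forall>(i, J) \<in> P. \<forall>j\<in>J. strongly_stable M (vqueue F \<pi> (i, J, j)))))"

definition achievable_region :: "flow set \<Rightarrow> (flow \<Rightarrow> real) set" where
  "achievable_region P = {r. rate_vector P r \<and> achievable P r}"

definition min_speedup :: "flow set \<Rightarrow> real" where
  "min_speedup P = Inf {s. 0 < s \<and> admissible_region P \<subseteq> scale_set s (achievable_region P)}"

definition subflows :: "flow set \<Rightarrow> subflow set" where
  "subflows P = {(i, J, j). (i, J) \<in> P \<and> j \<in> J}"

definition ecg_adj :: "subflow \<Rightarrow> subflow \<Rightarrow> bool" where
  "ecg_adj u v \<longleftrightarrow> u \<noteq> v \<and> (case u of (i, J, j) \<Rightarrow> case v of (i', J', j') \<Rightarrow>
      j = j' \<or> (i = i' \<and> J \<noteq> J'))"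

definition stable_set :: "flow set \<Rightarrow> subflow set \<Rightarrow> bool" where
  "stable_set P S \<longleftrightarrow> S \<subseteq> subflows P \<and> (\<forall>u\<in>S. \<forall>v\<in>S. \<not> ecg_adj u v)"

definition clique :: "flow set \<Rightarrow> subflow set \<Rightarrow> bool" where
  "clique P Q \<longleftrightarrow> Q \<subseteq> subflows P \<and> (\<forall>u\<in>Q. \<forall>v\<in>Q. u \<noteq> v \<longrightarrow> ecg_adj u v)"

definition STAB :: "flow set \<Rightarrow> (subflow \<Rightarrow> real) set" where
  "STAB P = {x. \<exists>w::subflow set \<Rightarrow> real. (\<forall>S. 0 \<le> w S) \<and>
      (\<Sum>S\<in>{S. stable_set P S}. w S) = 1 \<and>
      x = (\<lambda>v. \<Sum>S\<in>{S. stable_set P S}. w S * indicator S v)}"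

definition QSTAB :: "flow set \<Rightarrow> (subflow \<Rightarrow> real) set" where
  "QSTAB P = {x. (\<forall>v. v \<notin> subflows P \<longrightarrow> x v = 0) \<and> (\<forall>v. 0 \<le> x v) \<and>
      (\<forall>Q. clique P Q \<longrightarrow> (\<Sum>v\<in>Q. x v) \<le> 1)}"

definition imperfection_ratio :: "flow set \<Rightarrow> real" where
  "imperfection_ratio P = Inf {t. 0 \<le> t \<and> QSTAB P \<subseteq> scale_set t (STAB P)}"

end

theory Submission
  imports Defs "HOL-Algebra.Weak_Morphisms" "HOL-Number_Theory.Residues"
begin

text \<open>
  Cliques of the enhanced conflict graph consist of subflows with a common output or of subflows
  of different flows with a common input. Hence copying an admissible rate vector to the subflows
  gives a point of \<open>QSTAB\<close>, which lies in \<open>t STAB\<close>. For \<open>s > t\<close>, dividing the rates by \<open>s\<close>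
  leaves every subflow strictly below a convex combination of stable sets, so a periodic schedule
  of stable sets serves each subflow at a rate exceeding its arrival rate.

  Over a field with more than \<open>N\<close> elements, the knowledge spaces of the outputs that still lack
  some packet of a flow do not cover the knowledge space of the input (count vectors), so one
  coded packet can be innovative for all of them at once. Virtual queues are then dominated by
  single-server queues fed by the arrivals, and a multi-slot quadratic drift argument makes these
  strongly stable.
\<close>

section \<open>Linear coding over a finite field\<close>

text \<open>The residue ring modulo a prime above \<open>n\<close> serves. It lives on integers, so
  it is transported along \<open>nat\<close> to get a carrier of naturals.\<close>

lemma ex_large_finite_field:
  "\<exists>F :: nat ring. field F \<and> finite (carrier F) \<and> n < card (carrier F)"
proof -
  obtain p :: nat where p: "prime p" "n < p"
    using bigger_prime by blast
  define R where "R = residue_ring (int p)"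
  interpret residues_prime p R
    using p by (unfold_locales) (auto simp: R_def)
  have carr: "carrier R = {0..int p - 1}"
    by (simp add: R_def residue_ring_def)
  have inj: "inj_on nat (carrier R)"
    by (auto simp: inj_on_def carr)
  have "field (image_ring nat R)"
    using inj_imp_image_ring_is_field[OF inj] is_field by simp
  moreover have "carrier (image_ring nat R) = nat ` carrier R"
    by (rule image_ring_carrier)
  moreover have "card (nat ` carrier R) = p"
    using card_image[OF inj] carr by simp
  ultimately show ?thesis
    using p carr by (intro exI[of _ "image_ring nat R"]) auto
qed

locale finite_coeff_field = field F for F :: "nat ring" (structure) +
  assumes finite_carrier: "finite (carrier F)"
begin

section \<open>Spans of coefficient vectors\<close>

definition cvecs :: "cvec set" where
  "cvecs = {v. \<forall>k. v k \<in> carrier F}"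

lemma cvecsD: "v \<in> cvecs \<Longrightarrow> v k \<in> carrier F"
  by (simp add: cvecs_def)

lemma unitv_cvecs: "unitv F m \<in> cvecs"
  by (simp add: cvecs_def unitv_def)

lemma span_cvecs: "S \<subseteq> cvecs \<Longrightarrow> spanF F S \<subseteq> cvecs"
proof
  fix x assume "x \<in> spanF F S" "S \<subseteq> cvecs"
  then show "x \<in> cvecs"
    by (induction) (auto simp: vzero_def cvecs_def)
qed

lemma span_superset: "S \<subseteq> cvecs \<Longrightarrow> S \<subseteq> spanF F S"
proof
  fix v assume v: "v \<in> S" "S \<subseteq> cvecs"
  have "(\<lambda>k. (\<one> \<otimes> v k) \<oplus> vzero F k) \<in> spanF F S"
    by (intro spanF_add spanF_zero v one_closed)
  moreover have "(\<lambda>k. (\<one> \<otimes> v k) \<oplus> vzero F k) = v"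
    using v by (auto simp: vzero_def cvecs_def)
  ultimately show "v \<in> spanF F S"
    by simp
qed

text \<open>\<open>spanF\<close> only ever adds multiples of generators. Induction on the derivation
  of \<open>v\<close> extends this to multiples of arbitrary members of the span.\<close>

lemma span_lincomb:
  assumes "v \<in> spanF F S" "w \<in> spanF F S" "c \<in> carrier F" "S \<subseteq> cvecs"
  shows "(\<lambda>k. (c \<otimes> v k) \<oplus> w k) \<in> spanF F S"
  using assms
proof (induction)
  case spanF_zero
  have "w \<in> cvecs"
    using spanF_zero span_cvecs by blast
  then have "(\<lambda>k. (c \<otimes> vzero F k) \<oplus> w k) = w"
    using spanF_zero by (auto simp: vzero_def cvecs_def)
  then show ?case
    using spanF_zero by simp
next
  case (spanF_add v d u)
  have "(\<lambda>k. ((c \<otimes> d) \<otimes> v k) \<oplus> ((c \<otimes> u k) \<oplus> w k)) \<in> spanF F S"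
    using spanF_add by (auto intro: spanF.spanF_add)
  moreover have "v \<in> cvecs" "u \<in> cvecs" "w \<in> cvecs"
    using spanF_add span_cvecs by blast+
  then have "(\<lambda>k. ((c \<otimes> d) \<otimes> v k) \<oplus> ((c \<otimes> u k) \<oplus> w k))
      = (\<lambda>k. (c \<otimes> ((d \<otimes> v k) \<oplus> u k)) \<oplus> w k)"
    using spanF_add by (auto simp: cvecs_def r_distr m_assoc a_assoc)
  ultimately show ?case
    by simp
qed

lemma span_subset_span:
  assumes "S \<subseteq> spanF F T" "T \<subseteq> cvecs"
  shows "spanF F S \<subseteq> spanF F T"
proof
  fix x assume "x \<in> spanF F S"
  then show "x \<in> spanF F T"
    using assms by (induction) (auto intro: spanF_zero span_lincomb)
qed

lemma span_span: "S \<subseteq> cvecs \<Longrightarrow> spanF F (spanF F S) = spanF F S"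
  by (intro equalityI span_subset_span span_superset span_cvecs) auto

lemma span_mono: "S \<subseteq> T \<Longrightarrow> T \<subseteq> cvecs \<Longrightarrow> spanF F S \<subseteq> spanF F T"
  using span_subset_span span_superset by blast

lemma span_empty: "spanF F {} = {vzero F}"
proof -
  have "x = vzero F" if "x \<in> spanF F {}" for x
    using that by (induction) auto
  then show ?thesis
    by (auto intro: spanF_zero)
qed

text \<open>All occurrences of the new generator in a derivation collect into one coefficient
  \<open>c\<close>. The resulting parametrization by pairs is what the counting arguments below rest
  on.\<close>

lemma span_insert:
  assumes "S \<subseteq> cvecs" "v \<in> cvecs"
  shows "spanF F (insert v S) =
    (\<lambda>(c, w). \<lambda>k. (c \<otimes> v k) \<oplus> w k) ` (carrier F \<times> spanF F S)" (is "_ = ?R")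
proof
  have sub: "spanF F S \<subseteq> spanF F (insert v S)"
    using assms by (intro span_mono) auto
  then show "?R \<subseteq> spanF F (insert v S)"
    by (auto intro!: spanF_add)
  show "spanF F (insert v S) \<subseteq> ?R"
  proof
    fix x assume "x \<in> spanF F (insert v S)"
    then show "x \<in> ?R"
    proof (induction)
      case spanF_zero
      have "vzero F = (\<lambda>k. (\<zero> \<otimes> v k) \<oplus> vzero F k)"
        using assms by (auto simp: vzero_def cvecs_def)
      then show ?case
        by (intro image_eqI[where x = "(\<zero>, vzero F)"]) (auto intro: spanF.spanF_zero)
    next
      case (spanF_add u c x)
      then obtain d w where x: "x = (\<lambda>k. (d \<otimes> v k) \<oplus> w k)" "d \<in> carrier F" "w \<in> spanF F S"
        by auto
      have w: "w \<in> cvecs"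
        using x assms span_cvecs by blast
      show ?case
      proof (cases "u = v")
        case True
        have "(\<lambda>k. (c \<otimes> u k) \<oplus> x k) = (\<lambda>k. ((c \<oplus> d) \<otimes> v k) \<oplus> w k)"
          using x spanF_add w assms by (auto simp: True cvecs_def l_distr a_assoc)
        then show ?thesis
          using x spanF_add by (intro image_eqI[where x = "(c \<oplus> d, w)"]) auto
      next
        case False
        then have u: "u \<in> S"
          using spanF_add by simp
        have "(\<lambda>k. (c \<otimes> u k) \<oplus> x k) = (\<lambda>k. (d \<otimes> v k) \<oplus> ((c \<otimes> u k) \<oplus> w k))"
          using x spanF_add w assms u by (auto simp: cvecs_def a_lcomm subset_iff)
        then show ?thesis
          using x spanF_add u
          by (intro image_eqI[where x = "(d, \<lambda>k. (c \<otimes> u k) \<oplus> w k)"]) (auto intro: spanF.spanF_add)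
      qed
    qed
  qed
qed

lemma finite_span: "finite S \<Longrightarrow> S \<subseteq> cvecs \<Longrightarrow> finite (spanF F S)"
  by (induction S rule: finite_induct) (auto simp: span_empty span_insert finite_carrier)

lemma span_insert_redundant:
  assumes "S \<subseteq> cvecs" "v \<in> spanF F S"
  shows "spanF F (insert v S) = spanF F S"
proof -
  have "v \<in> cvecs"
    using assms span_cvecs by blast
  then show ?thesis
    using assms by (intro equalityI span_subset_span span_mono) (auto dest: span_superset)
qed

lemma card_span_insert_le:
  assumes "finite S" "S \<subseteq> cvecs" "v \<in> cvecs"
  shows "card (spanF F (insert v S)) \<le> card (carrier F) * card (spanF F S)"
proof -
  have "finite (carrier F \<times> spanF F S)"
    using finite_carrier assms by (simp add: finite_span)
  from card_image_le[OF this] show ?thesis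
    unfolding span_insert[OF assms(2,3)] card_cartesian_product .
qed

text \<open>The parametrization of \<open>span_insert\<close> is injective: two representations of a
  vector with different coefficients of \<open>v\<close> would put \<open>v\<close> itself into the
  span of \<open>S\<close>.\<close>

lemma card_span_insert:
  assumes "S \<subseteq> cvecs" "v \<in> cvecs" "v \<notin> spanF F S"
  shows "card (spanF F (insert v S)) = card (carrier F) * card (spanF F S)"
proof -
  have "inj_on (\<lambda>(c, w). \<lambda>k. (c \<otimes> v k) \<oplus> w k) (carrier F \<times> spanF F S)"
  proof (rule inj_onI, clarsimp)
    fix c w c' w'
    assume cw: "c \<in> carrier F" "w \<in> spanF F S" "c' \<in> carrier F" "w' \<in> spanF F S"
      and eq: "(\<lambda>k. c \<otimes> v k \<oplus> w k) = (\<lambda>k. c' \<otimes> v k \<oplus> w' k)"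
    have w: "w k \<in> carrier F" "w' k \<in> carrier F" "v k \<in> carrier F" for k
      using cw assms span_cvecs cvecsD by blast+
    have diff: "(c \<ominus> c') \<otimes> v k = w' k \<oplus> (\<ominus> w k)" for k
    proof -
      define x y where "x = c \<otimes> v k" and "y = c' \<otimes> v k"
      have xy: "x \<in> carrier F" "y \<in> carrier F"
        using cw w by (auto simp: x_def y_def)
      have "x \<oplus> w k = y \<oplus> w' k"
        using eq unfolding x_def y_def by meson
      then have "(x \<oplus> w k) \<oplus> (\<ominus> w k \<oplus> \<ominus> y) = (w' k \<oplus> y) \<oplus> (\<ominus> w k \<oplus> \<ominus> y)"
        using w xy by (simp add: a_comm)
      then have "x \<oplus> (w k \<oplus> (\<ominus> w k \<oplus> \<ominus> y)) = w' k \<oplus> (y \<oplus> (\<ominus> y \<oplus> \<ominus> w k))"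
        using w xy by (simp add: a_assoc a_comm[of "\<ominus> w k"])
      then have "x \<oplus> \<ominus> y = w' k \<oplus> \<ominus> w k"
        using w xy by (simp add: r_neg2)
      then show ?thesis
        using cw w by (simp add: x_def y_def minus_eq l_distr l_minus)
    qed
    have "c = c'"
    proof (rule ccontr)
      assume "c \<noteq> c'"
      then have nz: "c \<ominus> c' \<in> carrier F - {\<zero>}"
        using cw by (auto simp: r_right_minus_eq)
      \<comment> \<open>Dividing \<open>diff\<close> by the nonzero \<open>c \<ominus> c'\<close>
        expresses \<open>v\<close> as a combination of \<open>w\<close> and
        \<open>w'\<close>.\<close>
      define d where "d = inv (c \<ominus> c')"
      have d: "d \<in> carrier F" "d \<otimes> (c \<ominus> c') = \<one>"
        using nz unfolding d_def by (auto simp: field_Units)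
      have mw: "(\<lambda>k. (\<ominus> d) \<otimes> w k \<oplus> vzero F k) \<in> spanF F S"
        using cw assms d by (auto intro!: span_lincomb spanF_zero)
      have "(\<lambda>k. d \<otimes> w' k \<oplus> ((\<ominus> d) \<otimes> w k \<oplus> vzero F k)) \<in> spanF F S"
        using cw assms d mw by (auto intro!: span_lincomb)
      moreover have "(\<lambda>k. d \<otimes> w' k \<oplus> ((\<ominus> d) \<otimes> w k \<oplus> vzero F k)) = v"
      proof
        fix k
        have "v k = d \<otimes> ((c \<ominus> c') \<otimes> v k)"
          using d w nz by (simp flip: m_assoc)
        also have "\<dots> = d \<otimes> w' k \<oplus> ((\<ominus> d) \<otimes> w k \<oplus> vzero F k)"
          using w d unfolding diff by (simp add: r_distr vzero_def r_minus l_minus)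
        finally show "d \<otimes> w' k \<oplus> ((\<ominus> d) \<otimes> w k \<oplus> vzero F k) = v k" ..
      qed
      ultimately show False
        using assms by simp
    qed
    moreover have "w = w'"
    proof
      fix k
      have "w' k \<ominus> w k = \<zero>"
        using diff[of k] \<open>c = c'\<close> cw w by (simp add: minus_eq r_neg)
      then show "w k = w' k"
        using w by simp
    qed
    ultimately show "c = c' \<and> w = w'" ..
  qed
  then show ?thesis
    unfolding span_insert[OF assms(1,2)] by (simp add: card_image card_cartesian_product)
qed

section \<open>Dimension by counting vectors\<close>

lemma card_carrier_gt_1: "1 < card (carrier F)"
proof -
  have "card {\<zero>, \<one>} \<le> card (carrier F)"
    by (intro card_mono finite_carrier) auto
  then show ?thesis
    by simp
qed

lemma card_span_le:
  assumes "finite S" "S \<subseteq> cvecs"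
  shows "card (spanF F S) \<le> card (carrier F) ^ card S"
  using assms
proof (induction S rule: finite_induct)
  case (insert v S)
  then have "card (spanF F (insert v S)) \<le> card (carrier F) * card (spanF F S)"
    by (intro card_span_insert_le) auto
  also have "\<dots> \<le> card (carrier F) * card (carrier F) ^ card S"
    using insert by simp
  finally show ?case
    using insert by simp
qed (simp add: span_empty)

text \<open>Greedy selection: a vector is kept only if it lies outside the span so far, and then it
  multiplies the cardinality by exactly \<open>card (carrier F)\<close>.\<close>

lemma ex_basis:
  assumes "finite S" "S \<subseteq> cvecs"
  shows "\<exists>T\<subseteq>S. spanF F T = spanF F S \<and> card (spanF F S) = card (carrier F) ^ card T"
  using assms
proof (induction S rule: finite_induct)
  case (insert v S)
  then obtain T where T: "T \<subseteq> S" "spanF F T = spanF F S"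
    "card (spanF F S) = card (carrier F) ^ card T"
    by auto
  show ?case
  proof (cases "v \<in> spanF F S")
    case True
    then show ?thesis
      using T insert by (intro exI[of _ T]) (auto simp: span_insert_redundant)
  next
    case False
    have "v \<notin> T" "finite T"
      using T insert finite_subset by auto
    moreover have "spanF F (insert v T) = spanF F (insert v S)"
      using T insert span_insert[of T v] span_insert[of S v] by auto
    moreover have "card (spanF F (insert v S)) = card (carrier F) * card (spanF F S)"
      using False insert by (intro card_span_insert) auto
    ultimately show ?thesis
      using T by (intro exI[of _ "insert v T"]) auto
  qed
qed (simp add: span_empty)

text \<open>A generating set with \<open>n\<close> elements spans at most
  \<open>card (carrier F) ^ n\<close> vectors, so none is smaller than a basis from
  \<open>ex_basis\<close>. Dimensions can hence be compared by comparing cardinalities.\<close>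

lemma card_span_eq_power_dimF:
  assumes "finite S" "S \<subseteq> cvecs"
  shows "card (spanF F S) = card (carrier F) ^ dimF F S"
proof -
  obtain T where T: "T \<subseteq> S" "spanF F T = spanF F S"
    "card (spanF F S) = card (carrier F) ^ card T"
    using ex_basis[OF assms] by auto
  have "dimF F S = card T"
    unfolding dimF_def
  proof (rule Least_equality)
    show "\<exists>T'. finite T' \<and> card T' = card T \<and> T' \<subseteq> spanF F S \<and> spanF F T' = spanF F S"
      using T assms finite_subset[of T S] span_superset[of S] by (intro exI[of _ T]) auto
  next
    fix n assume "\<exists>T'. finite T' \<and> card T' = n \<and> T' \<subseteq> spanF F S \<and> spanF F T' = spanF F S"
    then obtain T' where T': "finite T'" "card T' = n" "T' \<subseteq> spanF F S" "spanF F T' = spanF F S"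
      by auto
    then have "card (carrier F) ^ card T \<le> card (carrier F) ^ n"
      using T card_span_le[of T'] assms span_cvecs[of S] by auto
    then show "card T \<le> n"
      using card_carrier_gt_1 by simp
  qed
  then show ?thesis
    using T by simp
qed

lemma dimF_eqI:
  assumes "finite S" "S \<subseteq> cvecs" "card (spanF F S) = card (carrier F) ^ n"
  shows "dimF F S = n"
  using assms card_span_eq_power_dimF[of S] card_carrier_gt_1 by simp

lemma dimF_cong_span:
  assumes "finite S" "S \<subseteq> cvecs" "finite T" "T \<subseteq> cvecs" "spanF F S = spanF F T"
  shows "dimF F S = dimF F T"
  using assms card_span_eq_power_dimF[of T] by (intro dimF_eqI) auto

lemma dimF_mono:
  assumes "finite T" "T \<subseteq> cvecs" "finite S" "S \<subseteq> spanF F T"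
  shows "dimF F S \<le> dimF F T"
proof -
  have S: "S \<subseteq> cvecs"
    using assms span_cvecs by blast
  have "card (spanF F S) \<le> card (spanF F T)"
    using assms by (intro card_mono finite_span span_subset_span)
  then show ?thesis
    using card_span_eq_power_dimF assms S card_carrier_gt_1 by simp
qed

lemma dimF_insert:
  assumes "finite S" "S \<subseteq> cvecs" "v \<in> cvecs" "v \<notin> spanF F S"
  shows "dimF F (insert v S) = Suc (dimF F S)"
  using assms card_span_insert[of S v] card_span_eq_power_dimF[of S] by (intro dimF_eqI) auto

text \<open>One missing vector already enlarges the smaller span by the factor
  \<open>card (carrier F)\<close> without leaving the larger one.\<close>

lemma proper_span_card:
  assumes "finite T" "T \<subseteq> cvecs" "S \<subseteq> spanF F T" "spanF F S \<noteq> spanF F T"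
  shows "card (carrier F) * card (spanF F S) \<le> card (spanF F T)"
proof -
  have S: "S \<subseteq> cvecs"
    using assms span_cvecs by blast
  have "spanF F S \<subseteq> spanF F T"
    using assms by (intro span_subset_span)
  then obtain v where v: "v \<in> spanF F T" "v \<notin> spanF F S"
    using assms by blast
  have "v \<in> cvecs"
    using v assms span_cvecs by blast
  then have "card (carrier F) * card (spanF F S) = card (spanF F (insert v S))"
    using S v by (simp add: card_span_insert)
  also have "\<dots> \<le> card (spanF F T)"
    using assms v by (intro card_mono finite_span span_subset_span) auto
  finally show ?thesis .
qed

text \<open>Each proper subspace fills at most the fraction \<open>1 / card (carrier F)\<close> of
  the space, so fewer than \<open>card (carrier F)\<close> of them cannot cover it. In the
  application \<open>I\<close> is a fanout set.\<close>

lemma ex_avoiding_proper_spans: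
  assumes "finite T" "T \<subseteq> cvecs" "finite I" "card I < card (carrier F)"
    "\<And>i. i \<in> I \<Longrightarrow> S i \<subseteq> spanF F T"
  shows "\<exists>v\<in>spanF F T. \<forall>i\<in>I. spanF F (S i) \<noteq> spanF F T \<longrightarrow> v \<notin> spanF F (S i)"
proof -
  define I' where "I' = {i\<in>I. spanF F (S i) \<noteq> spanF F T}"
  define U where "U = (\<Union>i\<in>I'. spanF F (S i))"
  have finT: "finite (spanF F T)"
    using assms by (intro finite_span)
  have I': "finite I'" "card I' \<le> card I"
    using assms by (auto simp: I'_def intro: card_mono)
  \<comment> \<open>Positivity makes the last inequality of the chain below strict.\<close>
  have Tpos: "0 < card (spanF F T)"
    using finT spanF_zero card_gt_0_iff by blast
  have "card (carrier F) * card U \<le> card (carrier F) * (\<Sum>i\<in>I'. card (spanF F (S i)))"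
    unfolding U_def by (intro mult_left_mono card_UN_le I') auto
  also have "\<dots> \<le> (\<Sum>i\<in>I'. card (spanF F T))"
    unfolding sum_distrib_left using assms
    by (intro sum_mono proper_span_card) (auto simp: I'_def)
  also have "\<dots> \<le> card I * card (spanF F T)"
    using I' by simp
  also have "\<dots> < card (carrier F) * card (spanF F T)"
    using assms Tpos by simp
  finally have "card U < card (spanF F T)"
    by simp
  moreover have "finite U"
    unfolding U_def
  proof (intro finite_UN_I I'(1))
    fix i assume "i \<in> I'"
    then show "finite (spanF F (S i))"
      using assms finT by (intro finite_subset[OF _ finT] span_subset_span) (auto simp: I'_def)
  qed
  ultimately have "\<not> spanF F T \<subseteq> U"
    using card_mono[of U "spanF F T"] by auto
  then show ?thesis
    unfolding U_def I'_def by blast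
qed

text \<open>All vectors spanned by the first \<open>n\<close> unit vectors vanish from coordinate
  \<open>n\<close> on, so each further unit vector raises the dimension by one.\<close>

lemma dimF_input_space: "dimF F (input_space F \<omega> f t) = cumA \<omega> f t"
proof -
  define U where "U n = unitv F ` {..<n}" for n
  have U: "U n \<subseteq> cvecs" "finite (U n)" for n
    by (auto simp: U_def unitv_cvecs)
  have zero: "x k = \<zero>" if "x \<in> spanF F (U n)" "n \<le> k" for x n k
    using that by (induction) (auto simp: vzero_def U_def unitv_def)
  have "dimF F (U n) = n" for n
  proof (induction n)
    case 0
    show ?case
      by (rule dimF_eqI) (auto simp: U_def span_empty)
  next
    case (Suc n)
    have "unitv F n \<notin> spanF F (U n)"
      using zero[of "unitv F n" n n] by (auto simp: unitv_def)
    then have "dimF F (insert (unitv F n) (U n)) = Suc n"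
      using U Suc by (simp add: dimF_insert unitv_cvecs)
    then show ?case
      by (simp add: U_def lessThan_Suc)
  qed
  moreover have "input_space F \<omega> f t = spanF F (U (cumA \<omega> f t))"
    unfolding input_space_def U_def by (intro arg_cong[where f = "spanF F"]) auto
  ultimately show ?thesis
    using U dimF_cong_span[of "spanF F (U (cumA \<omega> f t))" "U (cumA \<omega> f t)"]
    by (simp add: finite_span span_cvecs span_span)
qed

end

section \<open>Stability of queues with a service surplus\<close>

text \<open>Lindley recursion of a discrete-time queue. Service precedes the arrivals of the same
  slot, as in the switch, where \<open>input_space\<close> at \<open>t\<close> contains only packets
  that arrived before \<open>t\<close>.\<close>

primrec lindley :: "(nat \<Rightarrow> nat) \<Rightarrow> (nat \<Rightarrow> nat) \<Rightarrow> nat \<Rightarrow> nat" where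
  "lindley \<mu> a 0 = 0"
| "lindley \<mu> a (Suc t) = lindley \<mu> a t - \<mu> t + a t"

lemma sum_lessThan_add:
  "(\<Sum>k<m + n. g k) = (\<Sum>k<m. g k) + (\<Sum>k<n. g (m + k :: nat) :: 'a :: comm_monoid_add)"
  by (induction n) (auto simp: add_ac)

text \<open>Postponing all arrivals of a block until after its service can only waste more service,
  so the right-hand side is the larger queue.\<close>

lemma lindley_block:
  "lindley \<mu> a (t + B) \<le> (lindley \<mu> a t - (\<Sum>k<B. \<mu> (t + k))) + (\<Sum>k<B. a (t + k))"
  by (induction B) auto

lemma lindley_le_sum: "lindley \<mu> a t \<le> (\<Sum>s<t. a s)"
  by (induction t) auto

text \<open>The usual bound for the square of a queue after service \<open>m\<close> and arrivals
  \<open>a\<close>. The negative drift term \<open>2 * (u * m)\<close> stands on the left to avoid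
  truncated subtraction there.\<close>

lemma quadratic_drift:
  "((u::nat) - m + a)\<^sup>2 + 2 * (u * m) \<le> u\<^sup>2 + m\<^sup>2 + a\<^sup>2 + 2 * (u * a)"
proof (cases "u \<le> m")
  case False
  then obtain d where "u = m + d"
    using le_Suc_ex nat_le_linear by blast
  then show ?thesis
    by (simp add: power2_eq_square algebra_simps)
next
  case True
  then obtain d where "m = u + d"
    using le_Suc_ex by blast
  then show ?thesis
    by (simp add: power2_eq_square algebra_simps)
qed

lemma lindley_drift:
  "(lindley \<mu> a (t + B))\<^sup>2 + 2 * (lindley \<mu> a t * (\<Sum>k<B. \<mu> (t + k)))
     \<le> (lindley \<mu> a t)\<^sup>2 + (\<Sum>k<B. \<mu> (t + k))\<^sup>2 + (\<Sum>k<B. a (t + k))\<^sup>2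
       + 2 * (lindley \<mu> a t * (\<Sum>k<B. a (t + k)))"
proof -
  have "(lindley \<mu> a (t + B))\<^sup>2
      \<le> ((lindley \<mu> a t - (\<Sum>k<B. \<mu> (t + k))) + (\<Sum>k<B. a (t + k)))\<^sup>2"
    by (intro power_mono lindley_block) auto
  then show ?thesis
    using quadratic_drift[of "lindley \<mu> a t" "\<Sum>k<B. \<mu> (t + k)" "\<Sum>k<B. a (t + k)"]
    by linarith
qed

section \<open>Measurability with respect to the arrival history\<close>

lemma space_history: "space (history P t) = UNIV"
  by (simp add: history_def space_measure_of_conv)

lemma sets_history:
  "sets (history P t) = sigma_sets UNIV {{\<omega>. \<omega> s f = n} | s f n. s < t \<and> f \<in> P}"
  by (simp add: history_def sets_measure_of_conv)

lemma measurable_arrivals_history: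
  assumes "s < t" "f \<in> P"
  shows "(\<lambda>\<omega>. \<omega> s f) \<in> measurable (history P t) (count_space (UNIV :: nat set))"
  unfolding measurable_count_space_eq2_countable
proof (intro conjI ballI)
  fix n :: nat
  have "{\<omega>. \<omega> s f = n} \<in> sets (history P t)"
    unfolding sets_history using assms by (intro sigma_sets.Basic) blast
  then show "(\<lambda>\<omega>. \<omega> s f) -` {n} \<inter> space (history P t) \<in> sets (history P t)"
    by (simp add: space_history vimage_def)
qed auto

text \<open>The queue at time \<open>s\<close> is a function of the arrivals before
  \<open>s\<close>. This allows it to be moved through the conditional expectation given the
  history.\<close>

lemma measurable_lindley_history:
  assumes "f \<in> P" "s \<le> t"
  shows "(\<lambda>\<omega>. lindley \<mu> (\<lambda>k. \<omega> k f) s) \<in> measurable (history P t) (count_space UNIV)"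
  using assms(2)
proof (induction s)
  case (Suc s)
  have a: "(\<lambda>\<omega>. \<omega> s f) \<in> measurable (history P t) (count_space UNIV)"
    using Suc assms by (intro measurable_arrivals_history) auto
  have "(\<lambda>\<omega>. n - \<mu> s + \<omega> s f) \<in> measurable (history P t) (count_space UNIV)" for n
    using measurable_compose[OF a, of "\<lambda>m. n - \<mu> s + m"] by simp
  from measurable_compose_countable[OF this, of "\<lambda>\<omega>. lindley \<mu> (\<lambda>k. \<omega> k f) s"]
  show ?case
    using Suc by simp
qed simp

lemma subalgebra_history:
  assumes "space M = UNIV" "\<And>t f. (\<lambda>\<omega>. \<omega> t f) \<in> measurable M (count_space (UNIV :: nat set))"
  shows "subalgebra M (history P t)"
  unfolding subalgebra_def
proof
  show "space (history P t) = space M"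
    by (simp add: space_history assms)
  have "{\<omega>. \<omega> s f = n} \<in> sets M" for s f n
    using measurable_sets[OF assms(2), of "{n}" s f] by (simp add: assms(1) vimage_def)
  then have "sigma_sets (space M) {{\<omega>. \<omega> s f = n} | s f n. s < t \<and> f \<in> P} \<subseteq> sets M"
    by (intro sets.sigma_sets_subset) auto
  then show "sets (history P t) \<subseteq> sets M"
    by (simp add: sets_history assms(1))
qed

text \<open>Summing the \<open>B\<close>-slot drift over all starting times telescopes up to the first \<open>B\<close> terms.\<close>

lemma average_bound_from_drift:
  fixes u v :: "nat \<Rightarrow> real"
  assumes drift: "\<And>t. v (t + B) + c * u t \<le> v t + C" and "c > 0" and v0: "\<And>t. 0 \<le> v t"
  shows "(\<Sum>t<n. u t) \<le> (real n * C + (\<Sum>t<B. v t)) / c"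
proof -
  have "(\<Sum>t<n. v (t + B)) + (\<Sum>t<B. v t) = (\<Sum>t<n + B. v t)"
    by (induction n) (auto simp: add.commute)
  also have "\<dots> = (\<Sum>t<B + n. v t)"
    by (simp add: add.commute)
  also have "\<dots> \<ge> (\<Sum>t<n. v t)"
    by (intro sum_mono2) (auto simp: v0)
  finally have "(\<Sum>t<n. v t) \<le> (\<Sum>t<n. v (t + B)) + (\<Sum>t<B. v t)" .
  moreover have "(\<Sum>t<n. v (t + B) + c * u t) \<le> (\<Sum>t<n. v t + C)"
    by (intro sum_mono drift)
  ultimately have "c * (\<Sum>t<n. u t) \<le> real n * C + (\<Sum>t<B. v t)"
    by (simp add: sum.distrib sum_distrib_left)
  then show ?thesis
    using \<open>c > 0\<close> by (simp add: field_simps)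
qed

text \<open>Drift of the expected squared queue over long blocks: conditional mean arrivals exceed
  \<open>r f\<close> by at most \<open>\<epsilon> / 2\<close> per slot, service by at least
  \<open>\<epsilon>\<close>, and the remaining \<open>\<epsilon> / 2\<close> yields a decrease
  proportional to the queue. Nonnegative integrals are used until finiteness is known.\<close>

lemma strongly_stable_lindley:
  assumes arr: "arrival_process P r M" and f: "f \<in> P" and r: "0 \<le> r f" and "L > 0" "\<epsilon> > 0"
    and \<mu>: "\<And>t. \<mu> t \<le> 1"
    and service: "\<And>t. real L * (r f + \<epsilon>) \<le> real (\<Sum>k<L. \<mu> (t + k))"
  shows "strongly_stable M (\<lambda>t \<omega>. lindley \<mu> (\<lambda>s. \<omega> s f) t)"
proof -
  have prob: "prob_space M" and space: "space M = UNIV"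
    and meas[measurable]: "\<And>t f. (\<lambda>\<omega>. \<omega> t f) \<in> measurable M (count_space UNIV)"
    using arr by (auto simp: arrival_process_def)
  interpret prob_space M
    by (rule prob)
  obtain Amax :: real where Amax: "\<And>t. AE \<omega> in M.
      nn_cond_exp M (history P t) (\<lambda>\<omega>. ennreal ((real (\<omega> t f))\<^sup>2)) \<omega> \<le> ennreal (Amax\<^sup>2)"
    using arr f unfolding arrival_process_def by blast
  obtain T where T: "T > 0" "\<And>t. AE \<omega> in M.
      nn_cond_exp M (history P t) (\<lambda>\<omega>. ennreal ((\<Sum>k<T. real (\<omega> (t + k) f)) / real T)) \<omega>
        \<le> ennreal (r f + \<epsilon> / 2)"
    using arr f \<open>\<epsilon> > 0\<close> unfolding arrival_process_def by (meson half_gt_zero)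
  have sfs: "sigma_finite_subalgebra M (history P t)" for t
  proof -
    have "finite_measure_subalgebra M (history P t)"
      by (intro finite_measure_subalgebra.intro finite_measure_subalgebra_axioms.intro
          finite_measure_axioms subalgebra_history space meas)
    then show ?thesis
      by (rule finite_measure_subalgebra_is_sigma_finite)
  qed
  define U where "U t \<omega> = lindley \<mu> (\<lambda>s. \<omega> s f) t" for t \<omega>
  \<comment> \<open>A common multiple of the service window \<open>L\<close> and the arrival window
    \<open>T\<close>, so that a block splits into whole windows of either kind.\<close>
  define B where "B = L * T"
  have U_hist: "U s \<in> measurable (history P t) (count_space UNIV)" if "s \<le> t" for s t
    unfolding U_def using that f by (intro measurable_lindley_history)
  have [measurable]: "U t \<in> measurable M (count_space UNIV)" for t
    using U_hist[of t t] measurable_from_subalg[OF sigma_finite_subalgebra.subalg[OF sfs]] by blast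

  \<comment> \<open>The factor 1 in the second integral is the history-measurable weight that
    \<open>nn_cond_exp_intg\<close> expects.\<close>
  have second_moment: "(\<integral>\<^sup>+\<omega>. ennreal ((real (\<omega> t f))\<^sup>2) \<partial>M) \<le> ennreal (Amax\<^sup>2)" for t
  proof -
    have "(\<integral>\<^sup>+\<omega>. ennreal ((real (\<omega> t f))\<^sup>2) \<partial>M)
        = (\<integral>\<^sup>+\<omega>. 1 * nn_cond_exp M (history P t) (\<lambda>\<omega>. ennreal ((real (\<omega> t f))\<^sup>2)) \<omega> \<partial>M)"
      by (subst sigma_finite_subalgebra.nn_cond_exp_intg[OF sfs]) auto
    also have "\<dots> \<le> (\<integral>\<^sup>+\<omega>. ennreal (Amax\<^sup>2) \<partial>M)"
      using Amax[of t] by (intro nn_integral_mono_AE) auto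
    finally show ?thesis
      by (simp add: emeasure_space_1)
  qed
  \<comment> \<open>Cauchy-Schwarz bounds the square of the sum by \<open>n\<close> times the sum of
    squares; independence between slots is not assumed.\<close>
  have block_second_moment:
    "(\<integral>\<^sup>+\<omega>. ennreal ((\<Sum>k<n. real (\<omega> (t + k) f))\<^sup>2) \<partial>M) \<le> ennreal ((real n)\<^sup>2 * Amax\<^sup>2)" for t n
  proof -
    have "(\<integral>\<^sup>+\<omega>. ennreal ((\<Sum>k<n. real (\<omega> (t + k) f))\<^sup>2) \<partial>M)
        \<le> (\<integral>\<^sup>+\<omega>. ennreal (real n) * (\<Sum>k<n. ennreal ((real (\<omega> (t + k) f))\<^sup>2)) \<partial>M)"
    proof (intro nn_integral_mono)
      fix \<omega> :: arrivals
      have "(\<Sum>k<n. real (\<omega> (t + k) f))\<^sup>2 \<le> real n * (\<Sum>k<n. (real (\<omega> (t + k) f))\<^sup>2)"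
        using sum_squared_le_sum_of_squares[of "\<lambda>k. real (\<omega> (t + k) f)" "{..<n}"]
        by (simp add: mult.commute)
      then show "ennreal ((\<Sum>k<n. real (\<omega> (t + k) f))\<^sup>2)
          \<le> ennreal (real n) * (\<Sum>k<n. ennreal ((real (\<omega> (t + k) f))\<^sup>2))"
        by (subst sum_ennreal) (auto simp: ennreal_mult[symmetric] sum_nonneg ennreal_leI)
    qed
    also have "\<dots> = ennreal (real n) * (\<Sum>k<n. \<integral>\<^sup>+\<omega>. ennreal ((real (\<omega> (t + k) f))\<^sup>2) \<partial>M)"
      by (subst nn_integral_cmult) (auto simp: nn_integral_sum simp del: sum_ennreal)
    also have "\<dots> \<le> ennreal (real n) * (\<Sum>k<n. ennreal (Amax\<^sup>2))"
      by (intro mult_left_mono sum_mono second_moment) auto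
    also have "\<dots> = ennreal ((real n)\<^sup>2 * Amax\<^sup>2)"
      by (simp add: ennreal_mult[symmetric] ennreal_of_nat_eq_real_of_nat power2_eq_square mult.assoc)
    finally show ?thesis .
  qed

  define V where "V t = (\<integral>\<^sup>+\<omega>. ennreal ((real (U t \<omega>))\<^sup>2) \<partial>M)" for t
  define E where "E t = (\<integral>\<^sup>+\<omega>. ennreal (real (U t \<omega>)) \<partial>M)" for t
  have V_fin: "V t < \<infinity>" for t
  proof -
    have "V t \<le> (\<integral>\<^sup>+\<omega>. ennreal ((\<Sum>k<t. real (\<omega> (0 + k) f))\<^sup>2) \<partial>M)"
      unfolding V_def
    proof (intro nn_integral_mono ennreal_leI power_mono)
      fix \<omega>
      show "real (U t \<omega>) \<le> (\<Sum>k<t. real (\<omega> (0 + k) f))"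
        using lindley_le_sum[of \<mu> "\<lambda>s. \<omega> s f" t] unfolding U_def
        by (simp flip: of_nat_sum)
    qed auto
    also have "\<dots> \<le> ennreal ((real t)\<^sup>2 * Amax\<^sup>2)"
      by (rule block_second_moment)
    also have "\<dots> < \<infinity>"
      by simp
    finally show ?thesis .
  qed
  have E_fin: "E t < \<infinity>" for t
  proof -
    \<comment> \<open>A natural number is at most its square.\<close>
    have "E t \<le> V t"
      unfolding E_def V_def
      by (intro nn_integral_mono ennreal_leI) (simp add: power2_eq_square flip: of_nat_mult)
    then show ?thesis
      using V_fin by (rule le_less_trans)
  qed

  \<comment> \<open>Two times are kept apart: \<open>s\<close> is the start of the block, where the
    queue is observed, and \<open>t\<close> the start of an arrival window inside it. As
    \<open>s \<le> t\<close>, the queue belongs to the history at \<open>t\<close>.\<close>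
  have weighted_arrivals: "(\<integral>\<^sup>+\<omega>. ennreal (real (U s \<omega>)) * ennreal (\<Sum>k<T. real (\<omega> (t + k) f)) \<partial>M)
      \<le> ennreal (real T * (r f + \<epsilon> / 2)) * E s" if "s \<le> t" for s t
  proof -
    have [measurable]: "(\<lambda>\<omega>. ennreal (real (U s \<omega>))) \<in> borel_measurable (history P t)"
      using U_hist[OF that] by simp
    let ?g = "\<lambda>\<omega>. ennreal ((\<Sum>k<T. real (\<omega> (t + k) f)) / real T)"
    have scaled: "(\<integral>\<^sup>+\<omega>. ennreal (real (U s \<omega>)) * ennreal (\<Sum>k<T. real (\<omega> (t + k) f)) \<partial>M)
        = ennreal (real T) * (\<integral>\<^sup>+\<omega>. ennreal (real (U s \<omega>)) * ?g \<omega> \<partial>M)"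
      using T by (subst nn_integral_cmult[symmetric])
        (auto intro!: nn_integral_cong simp: ennreal_mult[symmetric] sum_nonneg)
    have "(\<integral>\<^sup>+\<omega>. ennreal (real (U s \<omega>)) * ?g \<omega> \<partial>M)
        = (\<integral>\<^sup>+\<omega>. ennreal (real (U s \<omega>)) * nn_cond_exp M (history P t) ?g \<omega> \<partial>M)"
      by (rule sigma_finite_subalgebra.nn_cond_exp_intg[OF sfs, symmetric]) measurable
    also have "\<dots> \<le> (\<integral>\<^sup>+\<omega>. ennreal (real (U s \<omega>)) * ennreal (r f + \<epsilon> / 2) \<partial>M)"
      using T(2)[of t] by (intro nn_integral_mono_AE) (auto elim!: eventually_mono intro!: mult_left_mono)
    also have "\<dots> = E s * ennreal (r f + \<epsilon> / 2)"
      unfolding E_def by (rule nn_integral_multc) measurable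
    finally have "ennreal (real T) * (\<integral>\<^sup>+\<omega>. ennreal (real (U s \<omega>)) * ?g \<omega> \<partial>M)
        \<le> ennreal (real T) * (E s * ennreal (r f + \<epsilon> / 2))"
      by (rule mult_left_mono) simp
    also have "\<dots> = ennreal (real T * (r f + \<epsilon> / 2)) * E s"
      using r \<open>\<epsilon> > 0\<close> by (simp only: ennreal_mult mult_ac)
    finally show ?thesis
      unfolding scaled .
  qed
  have block_arrivals:
    "(\<integral>\<^sup>+\<omega>. ennreal (real (U t \<omega>)) * ennreal (\<Sum>k<m * T. real (\<omega> (t + k) f)) \<partial>M)
      \<le> ennreal (real (m * T) * (r f + \<epsilon> / 2)) * E t" for t m
  proof (induction m)
    case (Suc m)
    have split: "(\<Sum>k<Suc m * T. real (\<omega> (t + k) f))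
        = (\<Sum>k<m * T. real (\<omega> (t + k) f)) + (\<Sum>k<T. real (\<omega> (t + m * T + k) f))" for \<omega>
      using sum_lessThan_add[of "\<lambda>k. real (\<omega> (t + k) f)" "m * T" T] by (simp add: add_ac)
    have "(\<integral>\<^sup>+\<omega>. ennreal (real (U t \<omega>)) * ennreal (\<Sum>k<Suc m * T. real (\<omega> (t + k) f)) \<partial>M)
        = (\<integral>\<^sup>+\<omega>. ennreal (real (U t \<omega>)) * ennreal (\<Sum>k<m * T. real (\<omega> (t + k) f))
            + ennreal (real (U t \<omega>)) * ennreal (\<Sum>k<T. real (\<omega> (t + m * T + k) f)) \<partial>M)"
      unfolding split by (simp add: sum_nonneg distrib_left)
    also have "\<dots> = (\<integral>\<^sup>+\<omega>. ennreal (real (U t \<omega>)) * ennreal (\<Sum>k<m * T. real (\<omega> (t + k) f)) \<partial>M)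
          + (\<integral>\<^sup>+\<omega>. ennreal (real (U t \<omega>)) * ennreal (\<Sum>k<T. real (\<omega> (t + m * T + k) f)) \<partial>M)"
      by (rule nn_integral_add) measurable
    also have "\<dots> \<le> ennreal (real (m * T) * (r f + \<epsilon> / 2)) * E t
          + ennreal (real T * (r f + \<epsilon> / 2)) * E t"
      by (intro add_mono Suc weighted_arrivals) simp
    also have "\<dots> = ennreal (real (Suc m * T) * (r f + \<epsilon> / 2)) * E t"
      using r \<open>\<epsilon> > 0\<close> by (simp add: distrib_right[symmetric] ennreal_plus[symmetric] del: ennreal_plus)
        (simp add: algebra_simps)
    finally show ?case .
  qed simp
  have block_service: "real (m * L) * (r f + \<epsilon>) \<le> real (\<Sum>k<m * L. \<mu> (t + k))" for t m
  proof (induction m)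
    case (Suc m)
    have "(\<Sum>k<Suc m * L. \<mu> (t + k)) = (\<Sum>k<m * L. \<mu> (t + k)) + (\<Sum>k<L. \<mu> (t + m * L + k))"
      using sum_lessThan_add[of "\<lambda>k. \<mu> (t + k)" "m * L" L] by (simp add: add_ac)
    then show ?case
      using Suc service[of "t + m * L"] by (simp add: algebra_simps)
  qed simp

  define v where "v t = enn2real (V t)" for t
  define e where "e t = enn2real (E t)" for t
  \<comment> \<open>The two terms bound the squared service of a block, at most \<open>B\<close>
    because \<open>\<mu> t \<le> 1\<close>, and the mean squared arrivals of a block.\<close>
  define C where "C = (real B)\<^sup>2 + (real B)\<^sup>2 * Amax\<^sup>2"
  define S where "S t = real (\<Sum>k<B. \<mu> (t + k))" for t
  have V_v: "V t = ennreal (v t)" and E_e: "E t = ennreal (e t)" for t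
    using V_fin[of t] E_fin[of t] by (auto simp: v_def e_def)
  have nonneg: "0 \<le> v t" "0 \<le> e t" "0 \<le> S t" for t
    by (auto simp: v_def e_def S_def sum_nonneg)
  have S_le: "S t \<le> real B" for t
    using sum_mono[of "{..<B}" "\<lambda>k. \<mu> (t + k)" "\<lambda>_. 1"] \<mu> by (simp add: S_def flip: of_nat_sum)
  have S_ge: "real B * (r f + \<epsilon>) \<le> S t" for t
    using block_service[of T t] by (simp add: S_def B_def mult.commute)
  \<comment> \<open>Arrivals contribute at most \<open>2 * B * (r f + \<epsilon> / 2) * e t\<close>
    and service removes at least \<open>2 * B * (r f + \<epsilon>) * e t\<close>; the difference is
    \<open>B * \<epsilon> * e t\<close>.\<close>
  have drift: "v (t + B) + real B * \<epsilon> * e t \<le> v t + C" for t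
  proof -
    let ?A = "\<lambda>\<omega>. \<Sum>k<B. real (\<omega> (t + k) f)"
    have "V (t + B) + ennreal (2 * S t) * E t
        = (\<integral>\<^sup>+\<omega>. ennreal ((real (U (t + B) \<omega>))\<^sup>2) + ennreal (2 * S t) * ennreal (real (U t \<omega>)) \<partial>M)"
      unfolding V_def E_def by (simp add: nn_integral_add nn_integral_cmult)
    also have "\<dots> \<le> (\<integral>\<^sup>+\<omega>. (ennreal ((real (U t \<omega>))\<^sup>2) + ennreal ((S t)\<^sup>2)) + (ennreal ((?A \<omega>)\<^sup>2)
        + ennreal 2 * (ennreal (real (U t \<omega>)) * ennreal (?A \<omega>))) \<partial>M)"
    proof (intro nn_integral_mono)
      fix \<omega> :: arrivals
      have "real ((U (t + B) \<omega>)\<^sup>2 + 2 * (U t \<omega> * (\<Sum>k<B. \<mu> (t + k))))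
        \<le> real ((U t \<omega>)\<^sup>2 + (\<Sum>k<B. \<mu> (t + k))\<^sup>2 + (\<Sum>k<B. \<omega> (t + k) f)\<^sup>2
           + 2 * (U t \<omega> * (\<Sum>k<B. \<omega> (t + k) f)))"
        unfolding U_def of_nat_le_iff by (rule lindley_drift)
      then have "(real (U (t + B) \<omega>))\<^sup>2 + 2 * S t * real (U t \<omega>)
          \<le> ((real (U t \<omega>))\<^sup>2 + (S t)\<^sup>2) + ((?A \<omega>)\<^sup>2 + 2 * (real (U t \<omega>) * ?A \<omega>))"
        by (simp add: S_def algebra_simps)
      moreover have "0 \<le> ?A \<omega>"
        by (simp add: sum_nonneg)
      ultimately show "ennreal ((real (U (t + B) \<omega>))\<^sup>2) + ennreal (2 * S t) * ennreal (real (U t \<omega>))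
          \<le> (ennreal ((real (U t \<omega>))\<^sup>2) + ennreal ((S t)\<^sup>2)) + (ennreal ((?A \<omega>)\<^sup>2)
            + ennreal 2 * (ennreal (real (U t \<omega>)) * ennreal (?A \<omega>)))"
        using nonneg by (simp flip: ennreal_mult ennreal_plus add: ennreal_leI del: ennreal_numeral)
    qed
    also have "\<dots> = (V t + ennreal ((S t)\<^sup>2)) + ((\<integral>\<^sup>+\<omega>. ennreal ((?A \<omega>)\<^sup>2) \<partial>M)
        + ennreal 2 * (\<integral>\<^sup>+\<omega>. ennreal (real (U t \<omega>)) * ennreal (?A \<omega>) \<partial>M))"
      unfolding V_def
      by (subst nn_integral_add; (measurable; fail)?)+
        (simp add: nn_integral_add nn_integral_cmult emeasure_space_1 del: ennreal_numeral)
    also have "\<dots> \<le> (V t + ennreal ((real B)\<^sup>2)) + (ennreal ((real B)\<^sup>2 * Amax\<^sup>2)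
        + ennreal 2 * (ennreal (real B * (r f + \<epsilon> / 2)) * E t))"
      using nonneg S_le
      by (intro add_mono mult_left_mono order_refl ennreal_leI power_mono block_second_moment
          block_arrivals[of t L, folded B_def]) auto
    finally have "v (t + B) + 2 * S t * e t \<le> (v t + (real B)\<^sup>2) + ((real B)\<^sup>2 * Amax\<^sup>2
        + 2 * (real B * (r f + \<epsilon> / 2) * e t))"
      using nonneg r \<open>\<epsilon> > 0\<close> unfolding V_v E_e
      by (simp flip: ennreal_mult ennreal_plus del: ennreal_numeral)
    moreover have "real B * (r f + \<epsilon>) * e t \<le> S t * e t"
      using nonneg by (intro mult_right_mono S_ge)
    ultimately show ?thesis
      by (simp add: C_def algebra_simps)
  qed
  have "real B * \<epsilon> > 0"
    using \<open>L > 0\<close> \<open>\<epsilon> > 0\<close> T(1) by (simp add: B_def)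
  note avg = average_bound_from_drift[where u = e and v = v, OF drift this nonneg(1)]
  define D where "D = (C + (\<Sum>t<B. v t)) / (real B * \<epsilon>)"
  \<comment> \<open>For \<open>t \<ge> 1\<close> the start-up term is at most \<open>t\<close> times
    itself, so one constant \<open>D\<close> bounds all these averages.\<close>
  have "(\<Sum>\<tau><t. E \<tau>) / of_nat t \<le> ennreal D" if "t \<ge> 1" for t
  proof -
    have "(\<Sum>\<tau><t. e \<tau>) \<le> (real t * C + (\<Sum>t<B. v t)) / (real B * \<epsilon>)"
      by (rule avg)
    also have "\<dots> \<le> (real t * C + real t * (\<Sum>t<B. v t)) / (real B * \<epsilon>)"
      using that \<open>real B * \<epsilon> > 0\<close> sum_nonneg[of "{..<B}" v] nonneg
        mult_right_mono[of 1 "real t" "\<Sum>t<B. v t"]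
      by (intro divide_right_mono add_left_mono) auto
    also have "\<dots> = real t * D"
      by (simp add: D_def algebra_simps)
    finally have "(\<Sum>\<tau><t. e \<tau>) / real t \<le> D"
      using that by (simp add: field_simps)
    moreover have "(\<Sum>\<tau><t. E \<tau>) / of_nat t = ennreal ((\<Sum>\<tau><t. e \<tau>) / real t)"
      using that nonneg unfolding E_e
      by (subst sum_ennreal) (auto simp: divide_ennreal sum_nonneg ennreal_of_nat_eq_real_of_nat)
    ultimately show ?thesis
      by (simp add: ennreal_leI)
  qed
  then have "limsup (\<lambda>t. (\<Sum>\<tau><t. E \<tau>) / of_nat t) \<le> ennreal D"
    by (intro Limsup_bounded eventually_sequentiallyI)
  then have "limsup (\<lambda>t. (\<Sum>\<tau><t. E \<tau>) / of_nat t) < \<infinity>"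
    by (rule le_less_trans) simp
  then show ?thesis
    unfolding strongly_stable_def E_def U_def .
qed

section \<open>Network coding along a schedule of stable sets\<close>

lemma strongly_stable_mono:
  assumes "strongly_stable M Q'" "\<And>t \<omega>. Q t \<omega> \<le> Q' t \<omega>"
  shows "strongly_stable M Q"
proof -
  have "limsup (\<lambda>t. (\<Sum>\<tau><t. \<integral>\<^sup>+ \<omega>. ennreal (real (Q \<tau> \<omega>)) \<partial>M) / of_nat t)
      \<le> limsup (\<lambda>t. (\<Sum>\<tau><t. \<integral>\<^sup>+ \<omega>. ennreal (real (Q' \<tau> \<omega>)) \<partial>M) / of_nat t)"
    using assms(2)
    by (intro Limsup_mono always_eventually allI divide_right_mono_ennreal sum_mono
        nn_integral_mono ennreal_leI) auto
  then show ?thesis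
    using assms(1) unfolding strongly_stable_def by (rule le_less_trans)
qed

definition slot_conn :: "subflow set \<Rightarrow> nat \<Rightarrow> flow option" where
  "slot_conn S j = (if \<exists>f. (fst f, snd f, j) \<in> S then Some (SOME f. (fst f, snd f, j) \<in> S) else None)"

text \<open>Distinct subflows with a common output are adjacent, so a stable set offers each output
  at most one flow and the choice in \<open>slot_conn\<close> is forced.\<close>

lemma slot_conn_eq_Some_iff:
  assumes "stable_set P S"
  shows "slot_conn S j = Some f \<longleftrightarrow> (fst f, snd f, j) \<in> S"
proof -
  have uniq: "f = g" if "(fst f, snd f, j) \<in> S" "(fst g, snd g, j) \<in> S" for f g :: flow
    using assms that unfolding stable_set_def ecg_adj_def by (fastforce simp: prod_eq_iff)
  show ?thesis
  proof (cases "\<exists>g. (fst g, snd g, j) \<in> S")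
    case True
    define h where "h = (SOME f :: flow. (fst f, snd f, j) \<in> S)"
    have "(fst h, snd h, j) \<in> S"
      unfolding h_def using True by (rule someI_ex)
    moreover have "slot_conn S j = Some h"
      unfolding slot_conn_def h_def using True by (rule if_P)
    ultimately show ?thesis
      using uniq[of h f] by auto
  next
    case False
    then show ?thesis
      unfolding slot_conn_def by simp
  qed
qed

text \<open>The packet is chosen to be innovative for every output of the fanout that still lacks
  something, whether or not that output is connected in slot \<open>t\<close>. The two
  \<open>spanF\<close> terms are the knowledge spaces produced by the earlier packets; existence of
  such a packet is the content of \<open>slot_code_spec\<close>.\<close>

function slot_code :: "nat ring \<Rightarrow> (nat \<Rightarrow> subflow set) \<Rightarrow> arrivals \<Rightarrow> flow \<Rightarrow> nat \<Rightarrow> cvec" where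
  "slot_code F \<sigma> \<omega> f t = (SOME v. v \<in> input_space F \<omega> f t \<and> (\<forall>j\<in>snd f.
     spanF F ((\<lambda>s. slot_code F \<sigma> \<omega> f s) ` {s. s < t \<and> (fst f, snd f, j) \<in> \<sigma> s})
       \<noteq> input_space F \<omega> f t \<longrightarrow>
     v \<notin> spanF F ((\<lambda>s. slot_code F \<sigma> \<omega> f s) ` {s. s < t \<and> (fst f, snd f, j) \<in> \<sigma> s})))"
  by auto
termination
  by (relation "Wellfounded.measure (\<lambda>(F, \<sigma>, \<omega>, f, t). t)") auto

declare slot_code.simps [simp del]

lemma cumA_mono: "s \<le> t \<Longrightarrow> cumA \<omega> f s \<le> cumA \<omega> f t"
  unfolding cumA_def by (intro sum_mono2) auto

lemma input_space_cong:
  assumes "\<And>s. s < t \<Longrightarrow> \<omega> s f = \<omega>' s f"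
  shows "input_space F \<omega> f t = input_space F \<omega>' f t"
  using assms by (simp add: input_space_def cumA_def)

text \<open>Causality: the input space and, by induction, the earlier packets depend only on past
  arrivals to \<open>f\<close>, hence so does the choice.\<close>

lemma slot_code_cong:
  assumes "\<And>s. s < t \<Longrightarrow> \<omega> s f = \<omega>' s f"
  shows "slot_code F \<sigma> \<omega> f t = slot_code F \<sigma> \<omega>' f t"
  using assms
proof (induction t rule: less_induct)
  case (less t)
  have "slot_code F \<sigma> \<omega> f ` {s. s < t \<and> X s} = slot_code F \<sigma> \<omega>' f ` {s. s < t \<and> X s}" for X
    using less by (intro image_cong) auto
  moreover have "input_space F \<omega> f t = input_space F \<omega>' f t"
    by (intro input_space_cong less.prems)
  ultimately show ?case
    unfolding slot_code.simps[of F \<sigma> _ f t] by simp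
qed

definition slot_known ::
    "nat ring \<Rightarrow> (nat \<Rightarrow> subflow set) \<Rightarrow> arrivals \<Rightarrow> flow \<Rightarrow> nat \<Rightarrow> nat \<Rightarrow> cvec set" where
  "slot_known F \<sigma> \<omega> f j t = slot_code F \<sigma> \<omega> f ` {s. s < t \<and> (fst f, snd f, j) \<in> \<sigma> s}"

lemma finite_slot_known: "finite (slot_known F \<sigma> \<omega> f j t)"
  by (simp add: slot_known_def)

lemma slot_known_Suc:
  "slot_known F \<sigma> \<omega> f j (Suc t) =
    (if (fst f, snd f, j) \<in> \<sigma> t then insert (slot_code F \<sigma> \<omega> f t) (slot_known F \<sigma> \<omega> f j t)
     else slot_known F \<sigma> \<omega> f j t)"
  by (auto simp: slot_known_def less_Suc_eq)

text \<open>Flows outside \<open>P\<close> get the zero vector because a policy may depend only on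
  arrivals to flows in \<open>P\<close>.\<close>

definition coded_policy ::
    "nat ring \<Rightarrow> flow set \<Rightarrow> (nat \<Rightarrow> subflow set) \<Rightarrow> nat \<Rightarrow> arrivals \<Rightarrow> decision" where
  "coded_policy F P \<sigma> t \<omega> =
    (slot_conn (\<sigma> t), \<lambda>f. if f \<in> P then slot_code F \<sigma> \<omega> f t else vzero F)"

lemma received_coded_policy:
  assumes "\<And>t. stable_set P (\<sigma> t)" "f \<in> P"
  shows "received (coded_policy F P \<sigma>) f j t \<omega> = slot_known F \<sigma> \<omega> f j t"
  using assms(2)
  by (auto simp: received_def coded_policy_def slot_known_def slot_conn_eq_Some_iff[OF assms(1)])

context finite_coeff_field
begin

section \<open>Innovative packets and domination of the virtual queues\<close>

lemma input_space_eq: "input_space F \<omega> f t = spanF F (unitv F ` {..<cumA \<omega> f t})"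
  unfolding input_space_def by (intro arg_cong[where f = "spanF F"]) auto

lemma input_space_cvecs: "input_space F \<omega> f t \<subseteq> cvecs"
  unfolding input_space_eq by (intro span_cvecs) (auto simp: unitv_cvecs)

lemma finite_input_space: "finite (input_space F \<omega> f t)"
  unfolding input_space_eq by (intro finite_span) (auto simp: unitv_cvecs)

lemma span_input_space: "spanF F (input_space F \<omega> f t) = input_space F \<omega> f t"
  unfolding input_space_eq by (intro span_span) (auto simp: unitv_cvecs)

lemma input_space_mono: "s \<le> t \<Longrightarrow> input_space F \<omega> f s \<subseteq> input_space F \<omega> f t"
  unfolding input_space_eq using cumA_mono[of s t \<omega> f]
  by (intro span_mono) (auto simp: unitv_cvecs)

text \<open>By induction all earlier packets lie in the current input space, so the knowledge spaces
  of the outputs are subspaces of it, and there are fewer of them than field elements.\<close>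

lemma slot_code_spec:
  assumes "finite (snd f)" "card (snd f) < card (carrier F)"
  shows "slot_code F \<sigma> \<omega> f t \<in> input_space F \<omega> f t \<and> (\<forall>j\<in>snd f.
    spanF F (slot_known F \<sigma> \<omega> f j t) \<noteq> input_space F \<omega> f t \<longrightarrow>
    slot_code F \<sigma> \<omega> f t \<notin> spanF F (slot_known F \<sigma> \<omega> f j t))"
proof (induction t rule: less_induct)
  case (less t)
  have "slot_code F \<sigma> \<omega> f s \<in> input_space F \<omega> f t" if "s < t" for s
    using less[OF that] input_space_mono[of s t \<omega> f] that by auto
  then have "slot_known F \<sigma> \<omega> f j t \<subseteq> input_space F \<omega> f t" for j
    unfolding slot_known_def by auto
  then have "\<exists>v\<in>input_space F \<omega> f t. \<forall>j\<in>snd f.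
      spanF F (slot_known F \<sigma> \<omega> f j t) \<noteq> input_space F \<omega> f t \<longrightarrow>
      v \<notin> spanF F (slot_known F \<sigma> \<omega> f j t)"
    using ex_avoiding_proper_spans[OF finite_input_space input_space_cvecs assms,
        of "\<lambda>j. slot_known F \<sigma> \<omega> f j t" \<omega> f t] unfolding span_input_space by simp
  then have "\<exists>v. v \<in> input_space F \<omega> f t \<and> (\<forall>j\<in>snd f.
      spanF F (slot_known F \<sigma> \<omega> f j t) \<noteq> input_space F \<omega> f t \<longrightarrow>
      v \<notin> spanF F (slot_known F \<sigma> \<omega> f j t))"
    by blast
  from someI_ex[OF this] show ?case
    unfolding slot_code.simps[of F \<sigma> \<omega> f t] slot_known_def[symmetric] .
qed

lemma slot_known_subset:
  assumes "finite (snd f)" "card (snd f) < card (carrier F)"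
  shows "slot_known F \<sigma> \<omega> f j t \<subseteq> input_space F \<omega> f t"
proof
  fix x assume "x \<in> slot_known F \<sigma> \<omega> f j t"
  then obtain s where "s < t" "x = slot_code F \<sigma> \<omega> f s"
    by (auto simp: slot_known_def)
  then show "x \<in> input_space F \<omega> f t"
    using slot_code_spec[OF assms, of \<sigma> \<omega> s] input_space_mono[of s t \<omega> f] by auto
qed

lemma valid_coded_policy:
  assumes "\<And>t. stable_set P (\<sigma> t)"
    and "\<And>f. f \<in> P \<Longrightarrow> finite (snd f) \<and> card (snd f) < card (carrier F)"
  shows "valid_policy F P (coded_policy F P \<sigma>)"
  unfolding valid_policy_def
proof (intro conjI allI impI)
  fix t and \<omega> \<omega>' :: arrivals assume "\<forall>s<t. \<forall>f\<in>P. \<omega> s f = \<omega>' s f"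
  then have "slot_code F \<sigma> \<omega> f t = slot_code F \<sigma> \<omega>' f t" if "f \<in> P" for f
    using that by (intro slot_code_cong) auto
  then show "coded_policy F P \<sigma> t \<omega> = coded_policy F P \<sigma> t \<omega>'"
    by (auto simp: coded_policy_def)
next
  fix t and \<omega> :: arrivals
  have stable: "stable_set P (\<sigma> t)"
    by (rule assms)
  have sub: "(i, J) \<in> P \<and> j \<in> J" if "(i, J, j) \<in> \<sigma> t" for i J j
    using stable that unfolding stable_set_def subflows_def by auto
  \<comment> \<open>Subflows of different flows at one input are adjacent, so a stable set makes
    each input transmit for a single flow.\<close>
  have same: "J = J'" if "(i, J, j) \<in> \<sigma> t" "(i, J', j') \<in> \<sigma> t" for i J J' j j'
    using stable that unfolding stable_set_def ecg_adj_def by fastforce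
  show "valid_decision F P \<omega> t (coded_policy F P \<sigma> t \<omega>)"
    unfolding valid_decision_def coded_policy_def fst_conv snd_conv
      slot_conn_eq_Some_iff[OF stable]
  proof (intro conjI allI impI)
    fix j f assume "(fst f, snd f, j) \<in> \<sigma> t"
    then have f: "f \<in> P" "j \<in> snd f"
      using sub[of "fst f" "snd f" j] by simp_all
    show "f \<in> P" "j \<in> snd f"
      by (rule f)+
    show "(if f \<in> P then slot_code F \<sigma> \<omega> f t else vzero F) \<in> input_space F \<omega> f t"
      using slot_code_spec assms(2) f(1) by simp
  next
    fix j j' i J J' assume "(i, J, j) \<in> \<sigma> t \<and> (i, J', j') \<in> \<sigma> t"
    then show "J = J'"
      using same by blast
  qed
qed

text \<open>In a slot that serves the subflow, either the output already knows everything or it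
  receives an innovative packet, so the virtual queue follows the Lindley recursion at least as
  fast.\<close>

lemma vqueue_coded_policy_le:
  assumes stable: "\<And>t. stable_set P (\<sigma> t)" and f: "f \<in> P"
    and J: "finite (snd f)" "card (snd f) < card (carrier F)" and j: "j \<in> snd f"
  shows "vqueue F (coded_policy F P \<sigma>) (fst f, snd f, j) t \<omega>
    \<le> lindley (\<lambda>t. of_bool ((fst f, snd f, j) \<in> \<sigma> t)) (\<lambda>s. \<omega> s f) t"
proof -
  define R where "R t = slot_known F \<sigma> \<omega> f j t" for t
  define D where "D t = dimF F (R t)" for t
  have vq: "vqueue F (coded_policy F P \<sigma>) (fst f, snd f, j) t \<omega> = cumA \<omega> f t - D t" for t
    using f by (simp add: vqueue_def dimF_input_space received_coded_policy[OF stable] R_def D_def)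
  have R: "R t \<subseteq> input_space F \<omega> f t" "finite (R t)" "R t \<subseteq> cvecs" for t
    using slot_known_subset[OF J] input_space_cvecs finite_slot_known unfolding R_def by blast+
  have dim_le: "dimF F S \<le> cumA \<omega> f t" if "S \<subseteq> input_space F \<omega> f t" for S t
    using dimF_mono[OF finite_input_space[of \<omega> f t] input_space_cvecs, of S] that
      finite_subset[OF that finite_input_space]
    by (simp add: dimF_input_space span_input_space)
  have D_le: "D t \<le> cumA \<omega> f t" for t
    unfolding D_def by (intro dim_le R)
  have step: "cumA \<omega> f (Suc t) - D (Suc t)
      \<le> (cumA \<omega> f t - D t) - of_bool ((fst f, snd f, j) \<in> \<sigma> t) + \<omega> t f" for t
  proof (cases "(fst f, snd f, j) \<in> \<sigma> t")
    case False
    then have "D (Suc t) = D t"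
      by (simp add: D_def R_def slot_known_Suc)
    then show ?thesis
      using False D_le[of t] by (simp add: cumA_def)
  next
    case True
    let ?v = "slot_code F \<sigma> \<omega> f t"
    have Suc: "R (Suc t) = insert ?v (R t)"
      using True by (simp add: R_def slot_known_Suc)
    have v: "?v \<in> input_space F \<omega> f t"
      using slot_code_spec[OF J] by blast
    show ?thesis
    proof (cases "spanF F (R t) = input_space F \<omega> f t")
      \<comment> \<open>The virtual queue is empty before the slot, so afterwards it holds at most
        the new arrivals.\<close>
      case eq: True
      then have "D t = dimF F (input_space F \<omega> f t)"
        unfolding D_def
        by (intro dimF_cong_span R finite_input_space input_space_cvecs) (simp add: span_input_space)
      moreover have "D t \<le> D (Suc t)"
        unfolding D_def Suc using R[of t] R[of "Suc t"] span_superset[of "R (Suc t)"]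
        by (intro dimF_mono) (auto simp: Suc)
      ultimately show ?thesis
        by (simp add: dimF_input_space cumA_def)
    next
      case False
      \<comment> \<open>The output lacks something, hence the packet is innovative and the queue is
        reduced by one before new arrivals.\<close>
      then have "?v \<notin> spanF F (R t)"
        using slot_code_spec[OF J, of \<sigma> \<omega> t] j unfolding R_def by blast
      then have "D (Suc t) = Suc (D t)"
        unfolding D_def Suc using v input_space_cvecs[of \<omega> f t] by (intro dimF_insert R) auto
      moreover have "D (Suc t) \<le> cumA \<omega> f t"
        unfolding D_def Suc using R[of t] v by (intro dim_le) auto
      ultimately show ?thesis
        using True by (simp add: cumA_def)
    qed
  qed
  have "cumA \<omega> f t - D t \<le> lindley (\<lambda>t. of_bool ((fst f, snd f, j) \<in> \<sigma> t)) (\<lambda>s. \<omega> s f) t"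
  proof (induction t)
    case (Suc t)
    have "cumA \<omega> f (Suc t) - D (Suc t)
        \<le> (cumA \<omega> f t - D t) - of_bool ((fst f, snd f, j) \<in> \<sigma> t) + \<omega> t f"
      by (rule step)
    also have "\<dots> \<le> lindley (\<lambda>t. of_bool ((fst f, snd f, j) \<in> \<sigma> t)) (\<lambda>s. \<omega> s f) (Suc t)"
      unfolding lindley.simps by (intro add_right_mono diff_le_mono Suc)
    finally show ?case .
  qed (simp add: cumA_def)
  then show ?thesis
    by (simp add: vq)
qed

end

section \<open>Stable set polytopes and periodic schedules\<close>

lemma finite_subflows:
  assumes "traffic_pattern K N P"
  shows "finite (subflows P)"
proof (rule finite_subset)
  show "subflows P \<subseteq> (\<lambda>((i, J), j). (i, J, j)) ` (P \<times> {1..N})"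
    using assms by (force simp: subflows_def traffic_pattern_def image_iff)
  show "finite ((\<lambda>((i, J), j). (i, J, j)) ` (P \<times> {1..N}))"
    using assms by (simp add: traffic_pattern_def)
qed

lemma finite_stable_sets: "finite (subflows P) \<Longrightarrow> finite {S. stable_set P S}"
  by (rule finite_subset[of _ "Pow (subflows P)"]) (auto simp: stable_set_def)

lemma stable_set_empty: "stable_set P {}"
  by (simp add: stable_set_def)

lemma stable_set_singleton: "v \<in> subflows P \<Longrightarrow> stable_set P {v}"
  by (simp add: stable_set_def ecg_adj_def)

text \<open>Any two members share an output or an input. If \<open>u\<close> and \<open>v\<close>
  have different inputs, a third member shares its input with at most one of them, hence its output
  with the other, and \<open>u\<close> and \<open>v\<close> have the same output.\<close>

lemma clique_same_output_or_input:
  assumes "clique P Q"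
  shows "(\<exists>j. \<forall>u\<in>Q. snd (snd u) = j) \<or> (\<exists>i. \<forall>u\<in>Q. fst u = i)"
proof (rule disjCI)
  have adj: "snd (snd u) = snd (snd v) \<or> fst u = fst v" if "u \<in> Q" "v \<in> Q" for u v
    using assms that unfolding clique_def ecg_adj_def by (fastforce split: prod.splits)
  assume "\<not> (\<exists>i. \<forall>u\<in>Q. fst u = i)"
  then obtain u v where uv: "u \<in> Q" "v \<in> Q" "fst u \<noteq> fst v"
    by metis
  then have "snd (snd w) = snd (snd u)" if "w \<in> Q" for w
    using adj that by metis
  then show "\<exists>j. \<forall>u\<in>Q. snd (snd u) = j"
    by blast
qed

definition flow_of :: "subflow \<Rightarrow> flow" where
  "flow_of u = (fst u, fst (snd u))"

text \<open>Distinct subflows of one flow differ in their outputs but not in input or fanout, so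
  they are not adjacent.\<close>

lemma inj_on_flow_of_clique: "clique P Q \<Longrightarrow> inj_on flow_of Q"
  unfolding inj_on_def clique_def ecg_adj_def flow_of_def by (fastforce split: prod.splits)

text \<open>A clique sum is a sum of rates of distinct flows through one output or from one input,
  which admissibility bounds by 1.\<close>

lemma admissible_imp_QSTAB:
  assumes "finite P" "a \<in> admissible_region P"
  shows "(\<lambda>u. if u \<in> subflows P then a (flow_of u) else 0) \<in> QSTAB P" (is "?x \<in> _")
proof -
  have nonneg: "0 \<le> a f" for f
    using assms(2) by (simp add: admissible_region_def rate_vector_def del: split_paired_All)
  have in_le: "(\<Sum>f\<in>{f\<in>P. fst f = i}. a f) \<le> 1"
    and out_le: "(\<Sum>f\<in>{f\<in>P. j \<in> snd f}. a f) \<le> 1" for i j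
    using assms by (auto simp: admissible_region_def)
  have "(\<Sum>u\<in>Q. ?x u) \<le> 1" if Q: "clique P Q" for Q
  proof -
    have sub: "Q \<subseteq> subflows P"
      using Q by (simp add: clique_def)
    then have "(\<Sum>u\<in>Q. ?x u) = (\<Sum>u\<in>Q. a (flow_of u))"
      by (intro sum.cong) auto
    also have "\<dots> = (\<Sum>f\<in>flow_of ` Q. a f)"
      by (simp add: sum.reindex inj_on_flow_of_clique[OF Q])
    also have "\<dots> \<le> 1"
      using clique_same_output_or_input[OF Q]
    proof (elim disjE exE)
      fix j assume "\<forall>u\<in>Q. snd (snd u) = j"
      then have "flow_of ` Q \<subseteq> {f\<in>P. j \<in> snd f}"
        using sub by (force simp: flow_of_def subflows_def)
      then have "(\<Sum>f\<in>flow_of ` Q. a f) \<le> (\<Sum>f\<in>{f\<in>P. j \<in> snd f}. a f)"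
        using assms(1) nonneg by (intro sum_mono2) auto
      with out_le show ?thesis
        by (rule order_trans[rotated])
    next
      fix i assume "\<forall>u\<in>Q. fst u = i"
      then have "flow_of ` Q \<subseteq> {f\<in>P. fst f = i}"
        using sub by (force simp: flow_of_def subflows_def)
      then have "(\<Sum>f\<in>flow_of ` Q. a f) \<le> (\<Sum>f\<in>{f\<in>P. fst f = i}. a f)"
        using assms(1) nonneg by (intro sum_mono2) auto
      with in_le show ?thesis
        by (rule order_trans[rotated])
    qed
    finally show ?thesis .
  qed
  then show ?thesis
    using nonneg by (simp add: QSTAB_def)
qed

text \<open>Makes the infimum in \<open>imperfection_ratio\<close> range over a nonempty set. A
  scaled-down point is a mixture of singletons, which are stable, and the empty set.\<close>

lemma QSTAB_subset_scaled_STAB: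
  assumes "finite (subflows P)"
  shows "QSTAB P \<subseteq> scale_set (real (card (subflows P)) + 1) (STAB P)"
proof
  let ?V = "subflows P" and ?\<S> = "{S. stable_set P S}"
  \<comment> \<open>The summand 1 keeps \<open>t\<close> positive when there are no
    subflows.\<close>
  define t where "t = real (card ?V) + 1"
  have "t > 0"
    by (simp add: t_def)
  fix x assume x: "x \<in> QSTAB P"
  have x0: "0 \<le> x v" "v \<notin> ?V \<Longrightarrow> x v = 0" for v
    using x unfolding QSTAB_def by blast+
  have x1: "x v \<le> 1" if "v \<in> ?V" for v
  proof -
    have "clique P {v}"
      using that by (simp add: clique_def)
    then have "(\<Sum>u\<in>{v}. x u) \<le> 1"
      using x unfolding QSTAB_def by blast
    then show ?thesis
      by simp
  qed
  \<comment> \<open>The weight left over by the singletons goes to the empty set.\<close>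
  define c0 where "c0 = 1 - (\<Sum>v\<in>?V. x v / t)"
  define w :: "subflow set \<Rightarrow> real" where
    "w S = (\<Sum>v\<in>?V. x v / t * of_bool (S = {v})) + c0 * of_bool (S = {})" for S
  have "(\<Sum>v\<in>?V. x v / t) \<le> (\<Sum>v\<in>?V. 1 / t)"
    using \<open>t > 0\<close> x1 by (intro sum_mono divide_right_mono) auto
  also have "\<dots> \<le> 1"
    using \<open>t > 0\<close> by (simp add: t_def)
  finally have "0 \<le> c0"
    by (simp add: c0_def)
  have fin: "finite ?\<S>"
    using assms by (rule finite_stable_sets)
  \<comment> \<open>Used with \<open>g\<close> constantly 1 for the total weight and with
    \<open>g\<close> an indicator for the coordinates.\<close>
  have weighted: "(\<Sum>S\<in>?\<S>. w S * g S) = (\<Sum>v\<in>?V. x v / t * g {v}) + c0 * g {}" for g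
  proof -
    have "(\<Sum>S\<in>?\<S>. w S * g S) = (\<Sum>S\<in>?\<S>. \<Sum>v\<in>?V. x v / t * (of_bool (S = {v}) * g S))
        + (\<Sum>S\<in>?\<S>. c0 * (of_bool (S = {}) * g S))"
      by (simp add: w_def distrib_right sum_distrib_right sum.distrib mult.assoc)
    also have "(\<Sum>S\<in>?\<S>. \<Sum>v\<in>?V. x v / t * (of_bool (S = {v}) * g S))
        = (\<Sum>v\<in>?V. x v / t * (\<Sum>S\<in>?\<S>. of_bool (S = {v}) * g S))"
      by (subst sum.swap) (simp add: sum_distrib_left)
    also have "\<dots> = (\<Sum>v\<in>?V. x v / t * g {v})"
    proof (intro sum.cong refl arg_cong2[where f = "(*)"])
      fix v assume "v \<in> ?V"
      then have "(\<Sum>S\<in>?\<S>. if S = {v} then g S else 0) = g {v}"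
        by (subst sum.delta[OF fin]) (simp add: stable_set_singleton)
      then show "(\<Sum>S\<in>?\<S>. of_bool (S = {v}) * g S) = g {v}"
        by (simp add: of_bool_def if_distrib[of "\<lambda>c. c * _"] cong: if_cong)
    qed
    also have "(\<Sum>S\<in>?\<S>. c0 * (of_bool (S = {}) * g S)) = c0 * g {}"
    proof -
      have "(\<Sum>S\<in>?\<S>. if S = {} then c0 * g S else 0) = c0 * g {}"
        by (subst sum.delta[OF fin]) (simp add: stable_set_empty)
      then show ?thesis
        by (simp add: of_bool_def if_distrib[of "\<lambda>c. c * _"] if_distrib[of "\<lambda>c. c0 * c"] cong: if_cong)
    qed
    finally show ?thesis .
  qed
  have eval: "t * (\<Sum>S\<in>?\<S>. w S * indicator S v) = x v" for v
  proof -
    have "(\<Sum>u\<in>?V. x u / t * indicator {u} v) = (\<Sum>u\<in>?V. if u = v then x u / t else 0)"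
      by (intro sum.cong) (auto simp: indicator_def)
    then show ?thesis
      using \<open>t > 0\<close> x0(2)[of v] assms unfolding weighted by simp
  qed
  have "(\<lambda>v. \<Sum>S\<in>?\<S>. w S * indicator S v) \<in> STAB P"
    unfolding STAB_def
  proof (intro CollectI exI conjI allI)
    show "0 \<le> w S" for S
      unfolding w_def using \<open>0 \<le> c0\<close> \<open>t > 0\<close> x0 by (intro add_nonneg_nonneg sum_nonneg) auto
    show "(\<Sum>S\<in>?\<S>. w S) = 1"
      using weighted[of "\<lambda>_. 1"] by (simp add: c0_def)
  qed (rule refl)
  then show "x \<in> scale_set (real (card ?V) + 1) (STAB P)"
    unfolding scale_set_def t_def[symmetric]
    by (intro CollectI exI[of _ "\<lambda>v. \<Sum>S\<in>?\<S>. w S * indicator S v"]) (simp add: eval)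
qed

section \<open>Periodic schedules from convex combinations\<close>

lemma sum_window_periodic:
  fixes h :: "nat \<Rightarrow> nat"
  assumes "\<And>k. h (k + L) = h k"
  shows "(\<Sum>k<L. h (t + k)) = (\<Sum>k<L. h k)"
proof (induction t)
  case (Suc t)
  have "h t + (\<Sum>k<L. h (Suc t + k)) = (\<Sum>k<Suc L. h (t + k))"
    by (subst sum.lessThan_Suc_shift) simp
  also have "\<dots> = h t + (\<Sum>k<L. h (t + k))"
    by (simp add: assms)
  finally show ?case
    using Suc by simp
qed simp

text \<open>Rounding the weights up lengthens the frame by at most \<open>card \<S>\<close> slots, which the slack
\<open>\<delta>\<close> absorbs once the frame is long.\<close>

lemma ex_periodic_schedule:
  fixes w :: "'a set \<Rightarrow> real"
  assumes fin: "finite \<S>" and w0: "\<And>S. S \<in> \<S> \<Longrightarrow> 0 \<le> w S" and w1: "(\<Sum>S\<in>\<S>. w S) = 1" and "\<delta> > 0"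
  obtains \<sigma> :: "nat \<Rightarrow> 'a set" and L where "L > 0" "\<And>t. \<sigma> t \<in> \<S>"
    "\<And>v t \<rho>. \<rho> + \<delta> \<le> (\<Sum>S\<in>\<S>. w S * indicator S v) \<Longrightarrow>
       real L * (\<rho> + \<delta> / 2) \<le> real (\<Sum>k<L. of_bool (v \<in> \<sigma> (t + k)))"
proof -
  obtain xs where xs: "set xs = \<S>" "distinct xs"
    using finite_distinct_list[OF fin] by blast
  \<comment> \<open>Chosen so that the \<open>card \<S>\<close> extra slots from rounding are at
    most \<open>M * (\<delta> / 2)\<close>.\<close>
  define M where "M = 1 + 2 * real (card \<S>) / \<delta>"
  have M: "M \<ge> 1" "real (card \<S>) \<le> M * (\<delta> / 2)"
    using \<open>\<delta> > 0\<close> by (auto simp: M_def field_simps)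
  define n where "n S = nat \<lceil>w S * M\<rceil>" for S
  have n: "w S * M \<le> real (n S)" "real (n S) \<le> w S * M + 1" if "S \<in> \<S>" for S
  proof -
    have "0 \<le> w S * M"
      using w0[OF that] M(1) by simp
    then have "real (n S) = of_int \<lceil>w S * M\<rceil>"
      by (simp add: n_def)
    then show "w S * M \<le> real (n S)" "real (n S) \<le> w S * M + 1"
      by linarith+
  qed
  define ys where "ys = concat (map (\<lambda>S. replicate (n S) S) xs)"
  define L where "L = length ys"
  define \<sigma> where "\<sigma> t = ys ! (t mod L)" for t
  have "length ys = (\<Sum>S\<leftarrow>xs. n S)"
    by (simp add: ys_def length_concat o_def)
  then have L: "L = (\<Sum>S\<in>\<S>. n S)"
    using xs by (simp add: L_def sum_list_distinct_conv_sum_set)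
  have "M = (\<Sum>S\<in>\<S>. w S * M)"
    by (simp add: w1 flip: sum_distrib_right)
  also have "\<dots> \<le> real L"
    unfolding L of_nat_sum by (intro sum_mono n)
  finally have L_ge: "M \<le> real L" .
  then have "L > 0"
    using M(1) by linarith
  have "real L \<le> (\<Sum>S\<in>\<S>. w S * M + 1)"
    unfolding L of_nat_sum by (intro sum_mono n)
  also have "\<dots> = M + real (card \<S>)"
    by (simp add: sum.distrib w1 flip: sum_distrib_right)
  finally have L_le: "real L \<le> M + real (card \<S>)" .
  have "set ys \<subseteq> \<S>"
    using xs by (auto simp: ys_def)
  then have \<sigma>_in: "\<sigma> t \<in> \<S>" for t
    using \<open>L > 0\<close> nth_mem[of "t mod L" ys] by (auto simp: \<sigma>_def L_def)
  have count: "(\<Sum>k<L. of_bool (v \<in> \<sigma> k)) = (\<Sum>S\<in>\<S>. n S * of_bool (v \<in> S))" for v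
  proof -
    have "(\<Sum>k<L. of_bool (v \<in> \<sigma> k)) = (\<Sum>k<length ys. of_bool (v \<in> ys ! k) :: nat)"
      unfolding L_def \<sigma>_def by (intro sum.cong) auto
    also have "\<dots> = (\<Sum>S\<leftarrow>ys. of_bool (v \<in> S))"
      by (simp add: sum_list_sum_nth atLeast0LessThan)
    also have "\<dots> = (\<Sum>S\<leftarrow>xs. n S * of_bool (v \<in> S))"
      unfolding ys_def by (induction xs) (simp_all add: sum_list_replicate)
    also have "\<dots> = (\<Sum>S\<in>\<S>. n S * of_bool (v \<in> S))"
      using xs by (simp add: sum_list_distinct_conv_sum_set)
    finally show ?thesis .
  qed
  have "real L * (\<rho> + \<delta> / 2) \<le> real (\<Sum>k<L. of_bool (v \<in> \<sigma> (t + k)))"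
    if \<rho>: "\<rho> + \<delta> \<le> (\<Sum>S\<in>\<S>. w S * indicator S v)" for v t \<rho>
  proof (cases "\<rho> + \<delta> / 2 \<le> 0")
    case True
    then show ?thesis
      by (meson mult_nonneg_nonpos of_nat_0_le_iff order_trans)
  next
    case False
    have "(\<Sum>S\<in>\<S>. w S * indicator S v) \<le> (\<Sum>S\<in>\<S>. w S)"
      using w0 by (intro sum_mono) (auto simp: indicator_def)
    \<comment> \<open>Since the demanded frequency is at most 1, lengthening the frame by
      \<open>card \<S>\<close> slots raises the demand by at most \<open>card \<S>\<close>.\<close>
    then have le_1: "\<rho> + \<delta> / 2 \<le> 1"
      using \<rho> w1 \<open>\<delta> > 0\<close> by simp
    have "real L * (\<rho> + \<delta> / 2) \<le> (M + real (card \<S>)) * (\<rho> + \<delta> / 2)"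
      using False L_le by (intro mult_right_mono) auto
    also have "\<dots> \<le> M * (\<rho> + \<delta> / 2) + real (card \<S>) * 1"
      using le_1 by (simp add: distrib_right mult_left_le)
    also have "\<dots> \<le> M * (\<rho> + \<delta>)"
      using M(2) by (simp add: algebra_simps)
    also have "\<dots> \<le> M * (\<Sum>S\<in>\<S>. w S * indicator S v)"
      using \<rho> M(1) by (intro mult_left_mono) auto
    also have "\<dots> = (\<Sum>S\<in>\<S>. (w S * M) * of_bool (v \<in> S))"
      by (simp add: sum_distrib_left indicator_def mult_ac)
    also have "\<dots> \<le> (\<Sum>S\<in>\<S>. real (n S) * of_bool (v \<in> S))"
      by (intro sum_mono mult_right_mono n) auto
    also have "\<dots> = real (\<Sum>k<L. of_bool (v \<in> \<sigma> k))"
      by (simp add: count)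
    also have "\<dots> = real (\<Sum>k<L. of_bool (v \<in> \<sigma> (t + k)))"
      using sum_window_periodic[of "\<lambda>k. of_bool (v \<in> \<sigma> k)" L t] by (simp add: \<sigma>_def)
    finally show ?thesis .
  qed
  with \<open>L > 0\<close> \<sigma>_in show thesis
    by (intro that[of L \<sigma>])
qed

section \<open>Speedup\<close>

text \<open>Half of the slack is spent on rounding the convex combination to a periodic schedule;
  the other half is the service surplus that stabilizes the dominating queues.\<close>

lemma achievable_of_slack:
  fixes w :: "subflow set \<Rightarrow> real"
  assumes P: "traffic_pattern K N P" and r0: "\<And>f. 0 \<le> r f"
    and w0: "\<And>S. 0 \<le> w S" and w1: "(\<Sum>S\<in>{S. stable_set P S}. w S) = 1" and "\<delta> > 0"
    and slack: "\<And>u. u \<in> subflows P \<Longrightarrow>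
      r (flow_of u) + \<delta> \<le> (\<Sum>S\<in>{S. stable_set P S}. w S * indicator S u)"
  shows "achievable P r"
  unfolding achievable_def
proof (intro allI impI)
  fix M assume M: "arrival_process P r M"
  obtain \<sigma> L where "L > 0" and \<sigma>_in: "\<And>t. \<sigma> t \<in> {S. stable_set P S}"
    and freq: "\<And>u t \<rho>. \<rho> + \<delta> \<le> (\<Sum>S\<in>{S. stable_set P S}. w S * indicator S u) \<Longrightarrow>
       real L * (\<rho> + \<delta> / 2) \<le> real (\<Sum>k<L. of_bool (u \<in> \<sigma> (t + k)))"
    by (rule ex_periodic_schedule[OF finite_stable_sets[OF finite_subflows[OF P]] w0 w1 \<open>\<delta> > 0\<close>])
      (rule that, assumption+)
  have \<sigma>: "stable_set P (\<sigma> t)" for t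
    using \<sigma>_in[of t] by simp
  obtain F :: "nat ring" where F: "field F" "finite (carrier F)" "N < card (carrier F)"
    using ex_large_finite_field by blast
  interpret finite_coeff_field F
    by (intro finite_coeff_field.intro finite_coeff_field_axioms.intro F)
  have fanout: "finite (snd f) \<and> card (snd f) < card (carrier F)" if "f \<in> P" for f
  proof -
    have "snd f \<subseteq> {1..N}"
      using P that unfolding traffic_pattern_def case_prod_beta by blast
    then have "finite (snd f)" "card (snd f) \<le> card {1..N}"
      by (blast intro: finite_subset card_mono finite_atLeastAtMost)+
    then show ?thesis
      using F(3) by simp
  qed
  have "strongly_stable M (vqueue F (coded_policy F P \<sigma>) (i, J, j))"
    if iJ: "(i, J) \<in> P" and j: "j \<in> J" for i J j
  proof (rule strongly_stable_mono)
    show "strongly_stable M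
        (\<lambda>t \<omega>. lindley (\<lambda>t. of_bool ((i, J, j) \<in> \<sigma> t)) (\<lambda>s. \<omega> s (i, J)) t)"
    proof (rule strongly_stable_lindley[OF M iJ r0 \<open>L > 0\<close>])
      show "real L * (r (i, J) + \<delta> / 2) \<le> real (\<Sum>k<L. of_bool ((i, J, j) \<in> \<sigma> (t + k)))" for t
        using slack[of "(i, J, j)"] iJ j by (intro freq) (simp add: subflows_def flow_of_def)
    qed (use \<open>\<delta> > 0\<close> in auto)
    show "vqueue F (coded_policy F P \<sigma>) (i, J, j) t \<omega>
        \<le> lindley (\<lambda>t. of_bool ((i, J, j) \<in> \<sigma> t)) (\<lambda>s. \<omega> s (i, J)) t" for t \<omega>
      by (rule vqueue_coded_policy_le[OF \<sigma> iJ, unfolded fst_conv snd_conv])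
        (use fanout[OF iJ] j in auto)
  qed
  then show "\<exists>F \<pi>. field F \<and> finite (carrier F) \<and> valid_policy F P \<pi> \<and>
      (\<forall>(i, J)\<in>P. \<forall>j\<in>J. strongly_stable M (vqueue F \<pi> (i, J, j)))"
    by (intro exI[of _ F] exI[of _ "coded_policy F P \<sigma>"] conjI F(1,2)
        valid_coded_policy[OF \<sigma> fanout]) auto
qed

text \<open>The rates copied to the subflows equal \<open>t * y\<close> with \<open>y\<close> in
  \<open>STAB P\<close>. Dividing by \<open>s\<close> leaves the positive weight
  \<open>1 - t / s\<close> for a strict service surplus.\<close>

lemma achievable_speedup:
  assumes P: "traffic_pattern K N P" and "0 \<le> t" and sub: "QSTAB P \<subseteq> scale_set t (STAB P)" and "t < s"
  shows "admissible_region P \<subseteq> scale_set s (achievable_region P)"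
proof
  let ?\<S> = "{S. stable_set P S}"
  have "s > 0"
    using assms by simp
  have fin: "finite ?\<S>"
    by (intro finite_stable_sets finite_subflows[OF P])
  then have card: "0 < real (card ?\<S>)"
    using stable_set_empty[of P] card_gt_0_iff by fastforce
  fix a assume a: "a \<in> admissible_region P"
  then have rv: "rate_vector P a"
    by (simp add: admissible_region_def)
  define x where "x u = (if u \<in> subflows P then a (flow_of u) else 0)" for u
  have "x \<in> QSTAB P"
    unfolding x_def using P a by (intro admissible_imp_QSTAB) (auto simp: traffic_pattern_def)
  then obtain y where y: "y \<in> STAB P" and "x = (\<lambda>u. t * y u)"
    using sub unfolding scale_set_def by blast
  then have x: "x u = t * y u" for u
    by simp
  obtain w :: "subflow set \<Rightarrow> real" where w: "\<And>S. 0 \<le> w S" "(\<Sum>S\<in>?\<S>. w S) = 1"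
    and "y = (\<lambda>u. \<Sum>S\<in>?\<S>. w S * indicator S u)"
    using y unfolding STAB_def by blast
  then have y_eq: "y u = (\<Sum>S\<in>?\<S>. w S * indicator S u)" for u
    by simp
  \<comment> \<open>The gap between \<open>t\<close> and \<open>s\<close> is spent on the uniform mixture of all stable sets, which serves
    every subflow, including those of rate 0.\<close>
  define \<delta> where "\<delta> = (1 - t / s) / real (card ?\<S>)"
  define w' where "w' S = t / s * w S + \<delta>" for S
  have "\<delta> > 0"
    using card \<open>t < s\<close> \<open>s > 0\<close> by (simp add: \<delta>_def)
  have "achievable P (\<lambda>f. a f / s)"
  proof (rule achievable_of_slack[OF P _ _ _ \<open>\<delta> > 0\<close>])
    show "0 \<le> a f / s" for f
      using rv \<open>s > 0\<close> unfolding rate_vector_def by (intro divide_nonneg_pos) blast+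
    show "0 \<le> w' S" for S
      using w(1)[of S] \<open>\<delta> > 0\<close> \<open>0 \<le> t\<close> \<open>s > 0\<close> by (simp add: w'_def)
    show "(\<Sum>S\<in>?\<S>. w' S) = 1"
      using w(2) card by (simp add: w'_def sum.distrib \<delta>_def flip: sum_divide_distrib sum_distrib_left)
    show "a (flow_of u) / s + \<delta> \<le> (\<Sum>S\<in>?\<S>. w' S * indicator S u)" if u: "u \<in> subflows P" for u
    proof -
      have "a (flow_of u) / s = t / s * y u"
        using x[of u] u by (simp add: x_def)
      also have "\<dots> = (\<Sum>S\<in>?\<S>. t / s * w S * indicator S u)"
        unfolding y_eq sum_distrib_left by (simp add: mult.assoc)
      finally have "(\<Sum>S\<in>?\<S>. w' S * indicator S u)
          = a (flow_of u) / s + (\<Sum>S\<in>?\<S>. \<delta> * indicator S u)"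
        by (simp add: w'_def distrib_right sum.distrib)
      \<comment> \<open>The singleton of \<open>u\<close> is one of the stable sets, so the uniform
        part serves \<open>u\<close> at rate at least \<open>\<delta>\<close>.\<close>
      moreover have "\<delta> * indicator {u} u \<le> (\<Sum>S\<in>?\<S>. \<delta> * indicator S u)"
        using stable_set_singleton[OF u] fin \<open>\<delta> > 0\<close> by (intro member_le_sum) auto
      ultimately show ?thesis
        by simp
    qed
  qed
  moreover have "rate_vector P (\<lambda>f. a f / s)"
    using rv \<open>s > 0\<close> by (simp add: rate_vector_def)
  ultimately have "(\<lambda>f. a f / s) \<in> achievable_region P"
    by (simp add: achievable_region_def)
  moreover have "a = (\<lambda>f. s * (a f / s))"
    using \<open>s > 0\<close> by simp
  ultimately show "a \<in> scale_set s (achievable_region P)"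
    unfolding scale_set_def by (intro CollectI exI[of _ "\<lambda>f. a f / s"] conjI)
qed

theorem theorem9:
  fixes K N :: nat and P :: "flow set"
  assumes "traffic_pattern K N P"
  shows "min_speedup P \<le> imperfection_ratio P"
  unfolding imperfection_ratio_def
proof (rule cInf_greatest)
  show "{t. 0 \<le> t \<and> QSTAB P \<subseteq> scale_set t (STAB P)} \<noteq> {}"
    using QSTAB_subset_scaled_STAB[OF finite_subflows[OF assms]]
    by (auto intro!: exI[of _ "real (card (subflows P)) + 1"])
next
  fix t assume "t \<in> {t. 0 \<le> t \<and> QSTAB P \<subseteq> scale_set t (STAB P)}"
  then have t: "0 \<le> t" "QSTAB P \<subseteq> scale_set t (STAB P)"
    by auto
  show "min_speedup P \<le> t"
  \<comment> \<open>Achievability is available only for speedups strictly above \<open>t\<close>;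
    letting \<open>e\<close> tend to 0 reaches \<open>t\<close> itself.\<close>
  proof (rule field_le_epsilon)
    fix e :: real assume "0 < e"
    then have "admissible_region P \<subseteq> scale_set (t + e) (achievable_region P)"
      by (intro achievable_speedup[OF assms t]) simp
    then show "min_speedup P \<le> t + e"
      unfolding min_speedup_def using t(1) \<open>0 < e\<close>
      by (intro cInf_lower) (auto intro: bdd_belowI[of _ 0])
  qed
qed

end
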